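(* Let $\mathbf C$ be a connected component of $\mathscr C$ with nonempty interior. Then $\sigma$ is continuous in $\overline{\mathbf C}\setminus\partial^c\mathbf C$.
   Context: Setting. $\Omega\subset\mathbb{R}^2$ is a bounded open set with Lipschitz boundary and outer unit normal $\nu$, $w\in H^1(\Omega)$, and $(u,\sigma,p)$ is a minimizer of $\frac12\int_\Omega|\sigma|^2dx+|p|(\overline\Omega)$ over all $(u,\sigma,p)\in BV(\Omega)\times L^2(\Omega;\mathbb{R}^2)\times\mathcal M(\overline\Omega;\mathbb{R}^2)$ with $Du=\sigma+p$ in $\Omega$ and $p=(w-u)\nu\mathcal H^1$ on $\partial\Omega$. The field $\sigma$ is unique, lies in $H^1_{\rm loc}(\Omega;\mathbb{R}^2)$, and satisfies $\operatorname{div}\sigma=0$, $|\sigma|\le1$. Standing hypothesis: $\Omega_p\subset\Omega$ is a nonempty convex open set with $|\sigma|=1$ a.e. on $\Omega_p$; then $\sigma$ has a locally Lipschitz representative on $\Omega_p$, which is used throughout. For $z=(z_1,z_2)$, $z^\perp=(-z_2,z_1)$. For $x\in\Omega_p$, $L_x:=x+\mathbb{R}\sigma^\perp(x)$ is the characteristic line through $x$; $\sigma$ is constant on $L_x\cap\Omega_p$, and two distinct characteristic lines do not meet inside $\Omega_p$. Fans. $\mathcal F$ is the set of $\bar z\in\partial\Omega_p$ for which there are $x\neq y$ in $\Omega_p$ with $L_x\cap L_y=\{\bar z\}$. For $\bar z\in\mathcal F$, $\mathbf F_{\bar z}:=\operatorname{int}\{z\in\Omega_p:\bar z\in L_z\}$.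 Set $\mathscr C:=\Omega_p\setminus\bigcup_{\bar z\in\mathcal F}\mathbf F_{\bar z}$. Boundaries, closures and interiors are taken in $\mathbb{R}^2$. For a connected component $\mathbf C$ of $\mathscr C$ with nonempty interior, $\partial^c\mathbf C$ is the set of all $x\in\partial\mathbf C\cap\partial\Omega_p$ such that $x\notin L_z$ for all $z\in\mathbf C$. For $x\in(\partial\mathbf C\cap\partial\Omega_p)\setminus\partial^c\mathbf C$ there is exactly one characteristic line $L_z$ with $z\in\mathbf C$ and $x\in L_z$, and $\sigma$ is extended to $x$ by $\sigma(x):=\sigma(z)$. The theorem concerns $\sigma$ so extended, as a function on $\overline{\mathbf C}\setminus\partial^c\mathbf C$. *)

theory Defs
  imports "HOL-Analysis.Analysis"
begin

type_synonym plane = "real^2"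

section \<open>Lipschitz domains, Hausdorff measure and the outer normal\<close>

definition perp :: "plane \<Rightarrow> plane" where
  "perp z = vector [- (z $ 2), z $ 1]"

text \<open>In suitable orthonormal coordinates around each boundary point, the set is locally the
  strict epigraph of a Lipschitz function of one variable.\<close>

definition lipschitz_boundary :: "plane set \<Rightarrow> bool" where
  "lipschitz_boundary \<Omega> \<longleftrightarrow>
     (\<forall>x\<in>frontier \<Omega>. \<exists>r>0. \<exists>e \<gamma> K. norm e = 1 \<and> K-lipschitz_on (UNIV :: real set) \<gamma> \<and>
        \<Omega> \<inter> ball x r = {y \<in> ball x r. \<gamma> (y \<bullet> e) < y \<bullet> perp e})"

text \<open>One-dimensional Hausdorff measure. In dimension one the normalising constant of the
  coverings is 1, so diameters are summed as they are. The boundedness condition is needed because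
  the library's diameter of an unbounded set is a junk value. The outer measure is restricted to
  Borel sets, on which it is countably additive by Caratheodory's criterion.\<close>

definition hausdorff1_outer :: "plane set \<Rightarrow> ennreal" where
  "hausdorff1_outer A =
     (SUP \<delta>\<in>{0<..}. INF C\<in>{C :: nat \<Rightarrow> plane set. A \<subseteq> (\<Union>n. C n) \<and>
                                (\<forall>n. bounded (C n) \<and> diameter (C n) \<le> \<delta>)}.
        (\<Sum>n. ennreal (diameter (C n))))"

definition hausdorff1 :: "plane measure" where
  "hausdorff1 = measure_of UNIV (sets borel) hausdorff1_outer"

text \<open>The outer unit normal at a boundary point at which the boundary is differentiable: up to a
  cone of arbitrarily small opening around the tangent line, the set coincides near the point with
  the half-plane opposite to the normal. For a Lipschitz boundary such a vector exists at
  \<open>\<H>\<^sup>1\<close>-a.e. boundary point (Rademacher), and it is unique wherever it exists.\<close>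

definition is_outer_normal :: "plane set \<Rightarrow> plane \<Rightarrow> plane \<Rightarrow> bool" where
  "is_outer_normal \<Omega> x n \<longleftrightarrow> norm n = 1 \<and>
     (\<forall>\<epsilon>>0. \<exists>\<delta>>0. \<forall>y\<in>ball x \<delta>.
        ((y - x) \<bullet> n < - \<epsilon> * norm (y - x) \<longrightarrow> y \<in> \<Omega>) \<and>
        ((y - x) \<bullet> n > \<epsilon> * norm (y - x) \<longrightarrow> y \<notin> \<Omega>))"

definition outer_normal :: "plane set \<Rightarrow> plane \<Rightarrow> plane" where
  "outer_normal \<Omega> x = (THE n. is_outer_normal \<Omega> x n)"

section \<open>Vector measures\<close>

text \<open>Finite vector-valued Borel measures are countably additive set functions; only their values
  on Borel sets matter. The variation is the supremum over countable Borel partitions.\<close>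

definition variation :: "(plane set \<Rightarrow> plane) \<Rightarrow> plane set \<Rightarrow> ennreal" where
  "variation P A =
     (SUP B\<in>{B :: nat \<Rightarrow> plane set. range B \<subseteq> sets borel \<and> disjoint_family B \<and> (\<Union>n. B n) = A}.
        (\<Sum>n. ennreal (norm (P (B n)))))"

definition vector_measure :: "(plane set \<Rightarrow> plane) \<Rightarrow> bool" where
  "vector_measure P \<longleftrightarrow>
     (\<forall>B :: nat \<Rightarrow> plane set. range B \<subseteq> sets borel \<longrightarrow> disjoint_family B \<longrightarrow>
        (\<lambda>n. P (B n)) sums P (\<Union>n. B n)) \<and>
     variation P UNIV < \<infinity>"

text \<open>A measure on a Borel set \<open>K\<close> is a measure on the plane that is concentrated on \<open>K\<close>.\<close>

definition vector_measure_on :: "plane set \<Rightarrow> (plane set \<Rightarrow> plane) \<Rightarrow> bool" where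
  "vector_measure_on K P \<longleftrightarrow> vector_measure P \<and> (\<forall>B\<in>sets borel. P B = P (B \<inter> K))"

text \<open>\<open>has_signed_integral m f c\<close> says that \<open>c\<close> is the integral of \<open>f\<close> against the signed measure \<open>m\<close>.
  A decomposition into finite positive measures exists by the Jordan decomposition, and
  for bounded Borel \<open>f\<close> the value does not depend on the decomposition.\<close>

definition has_signed_integral :: "(plane set \<Rightarrow> real) \<Rightarrow> (plane \<Rightarrow> real) \<Rightarrow> real \<Rightarrow> bool" where
  "has_signed_integral m f c \<longleftrightarrow>
     (\<exists>\<mu> \<nu>. finite_measure \<mu> \<and> finite_measure \<nu> \<and> sets \<mu> = sets borel \<and> sets \<nu> = sets borel \<and>
        (\<forall>B\<in>sets borel. m B = measure \<mu> B - measure \<nu> B) \<and>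
        integrable \<mu> f \<and> integrable \<nu> f \<and>
        c = (LINT x|\<mu>. f x) - (LINT x|\<nu>. f x))"

section \<open>Function spaces\<close>

definition L2_on :: "plane set \<Rightarrow> (plane \<Rightarrow> 'a::{banach, second_countable_topology}) \<Rightarrow> bool" where
  "L2_on \<Omega> f \<longleftrightarrow> set_borel_measurable lebesgue \<Omega> f \<and>
     set_integrable lebesgue \<Omega> (\<lambda>x. (norm (f x))\<^sup>2)"

definition pderiv_at :: "2 \<Rightarrow> (plane \<Rightarrow> real) \<Rightarrow> plane \<Rightarrow> real" where
  "pderiv_at i \<phi> x = frechet_derivative \<phi> (at x) (axis i 1)"

text \<open>Test functions are of class \<open>C\<^sup>1\<close> with compact support in \<open>\<Omega>\<close>; by mollification they
  determine the same weak derivatives as smooth ones.\<close>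

definition test_function :: "plane set \<Rightarrow> (plane \<Rightarrow> real) \<Rightarrow> bool" where
  "test_function \<Omega> \<phi> \<longleftrightarrow>
     (\<forall>x. \<phi> differentiable (at x)) \<and> (\<forall>i. continuous_on UNIV (pderiv_at i \<phi>)) \<and>
     (\<exists>K. compact K \<and> K \<subseteq> \<Omega> \<and> (\<forall>x. x \<notin> K \<longrightarrow> \<phi> x = 0))"

definition H1_on :: "plane set \<Rightarrow> (plane \<Rightarrow> real) \<Rightarrow> bool" where
  "H1_on \<Omega> w \<longleftrightarrow> L2_on \<Omega> w \<and>
     (\<exists>G :: plane \<Rightarrow> plane. L2_on \<Omega> G \<and>
        (\<forall>\<phi> i. test_function \<Omega> \<phi> \<longrightarrow>
           (LINT x:\<Omega>|lebesgue. w x * pderiv_at i \<phi> x) = - (LINT x:\<Omega>|lebesgue. \<phi> x * G x $ i)))"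

text \<open>\<open>has_gradient_measure \<Omega> u m\<close> says \<open>Du = m\<close> in \<open>\<Omega>\<close> in the sense of distributions.\<close>

definition has_gradient_measure ::
  "plane set \<Rightarrow> (plane \<Rightarrow> real) \<Rightarrow> (plane set \<Rightarrow> plane) \<Rightarrow> bool" where
  "has_gradient_measure \<Omega> u m \<longleftrightarrow>
     (\<forall>\<phi> i. test_function \<Omega> \<phi> \<longrightarrow>
        has_signed_integral (\<lambda>B. m B $ i) \<phi> (- (LINT x:\<Omega>|lebesgue. u x * pderiv_at i \<phi> x)))"

definition BV_on :: "plane set \<Rightarrow> (plane \<Rightarrow> real) \<Rightarrow> bool" where
  "BV_on \<Omega> u \<longleftrightarrow> set_integrable lebesgue \<Omega> u \<and>
     (\<exists>m. vector_measure m \<and> has_gradient_measure \<Omega> u m)"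

text \<open>Boundary trace of a \<open>BV\<close> (in particular, of an \<open>H\<^sup>1\<close>) function on a bounded Lipschitz domain,
  characterised up to \<open>\<H>\<^sup>1\<close>-null sets by vanishing mean oscillation about the trace value.
  The function \<open>g\<close> is arbitrary off the boundary.\<close>

definition has_trace :: "plane set \<Rightarrow> (plane \<Rightarrow> real) \<Rightarrow> (plane \<Rightarrow> real) \<Rightarrow> bool" where
  "has_trace \<Omega> u g \<longleftrightarrow> g \<in> borel_measurable borel \<and>
     (AE x in hausdorff1. x \<in> frontier \<Omega> \<longrightarrow>
        ((\<lambda>r. (LINT y:\<Omega> \<inter> ball x r|lebesgue. \<bar>u y - g x\<bar>) / r\<^sup>2) \<longlongrightarrow> 0) (at_right 0))"

section \<open>The variational problem\<close>

text \<open>The two last conjuncts are \<open>Du = \<sigma> + p\<close> in \<open>\<Omega>\<close>, where \<open>\<sigma>\<close> stands for the measure with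
  Lebesgue density \<open>\<sigma>\<close>, and \<open>p = (w - u) \<nu> \<H>\<^sup>1\<close> on the boundary, with \<open>w\<close> and \<open>u\<close> understood
  as traces.\<close>

definition admissible :: "plane set \<Rightarrow> (plane \<Rightarrow> real) \<Rightarrow>
    (plane \<Rightarrow> real) \<Rightarrow> (plane \<Rightarrow> plane) \<Rightarrow> (plane set \<Rightarrow> plane) \<Rightarrow> bool" where
  "admissible \<Omega> w u \<sigma> p \<longleftrightarrow>
     BV_on \<Omega> u \<and> L2_on \<Omega> \<sigma> \<and> vector_measure_on (closure \<Omega>) p \<and>
     has_gradient_measure \<Omega> u (\<lambda>B. (LINT x:B \<inter> \<Omega>|lebesgue. \<sigma> x) + p B) \<and>
     (\<exists>tu tw. has_trace \<Omega> u tu \<and> has_trace \<Omega> w tw \<and>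
        (\<forall>B\<in>sets borel. B \<subseteq> frontier \<Omega> \<longrightarrow>
           set_integrable hausdorff1 B (\<lambda>x. (tw x - tu x) *\<^sub>R outer_normal \<Omega> x) \<and>
           p B = (LINT x:B|hausdorff1. (tw x - tu x) *\<^sub>R outer_normal \<Omega> x)))"

definition energy :: "plane set \<Rightarrow> (plane \<Rightarrow> plane) \<Rightarrow> (plane set \<Rightarrow> plane) \<Rightarrow> ennreal" where
  "energy \<Omega> \<sigma> p =
     ennreal (1/2 * (LINT x:\<Omega>|lebesgue. (norm (\<sigma> x))\<^sup>2)) + variation p (closure \<Omega>)"

definition minimizer :: "plane set \<Rightarrow> (plane \<Rightarrow> real) \<Rightarrow>
    (plane \<Rightarrow> real) \<Rightarrow> (plane \<Rightarrow> plane) \<Rightarrow> (plane set \<Rightarrow> plane) \<Rightarrow> bool" where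
  "minimizer \<Omega> w u \<sigma> p \<longleftrightarrow> admissible \<Omega> w u \<sigma> p \<and>
     (\<forall>v \<tau> q. admissible \<Omega> w v \<tau> q \<longrightarrow> energy \<Omega> \<sigma> p \<le> energy \<Omega> \<tau> q)"

section \<open>Characteristic lines and fans\<close>

text \<open>From here on \<open>s\<close> is the locally Lipschitz representative of \<open>\<sigma>\<close> on the open convex set \<open>U\<close>.\<close>

definition locally_lipschitz_on :: "plane set \<Rightarrow> (plane \<Rightarrow> plane) \<Rightarrow> bool" where
  "locally_lipschitz_on U s \<longleftrightarrow> (\<forall>x\<in>U. \<exists>r>0. \<exists>K. K-lipschitz_on (ball x r \<inter> U) s)"

definition char_line :: "(plane \<Rightarrow> plane) \<Rightarrow> plane \<Rightarrow> plane set" where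
  "char_line s x = {x + t *\<^sub>R perp (s x) | t. True}"

definition fan_apexes :: "(plane \<Rightarrow> plane) \<Rightarrow> plane set \<Rightarrow> plane set" where
  "fan_apexes s U =
     {b \<in> frontier U. \<exists>x\<in>U. \<exists>y\<in>U. x \<noteq> y \<and> char_line s x \<inter> char_line s y = {b}}"

definition fan :: "(plane \<Rightarrow> plane) \<Rightarrow> plane set \<Rightarrow> plane \<Rightarrow> plane set" where
  "fan s U b = interior {z \<in> U. b \<in> char_line s z}"

definition fan_complement :: "(plane \<Rightarrow> plane) \<Rightarrow> plane set \<Rightarrow> plane set" where
  "fan_complement s U = U - (\<Union>b\<in>fan_apexes s U. fan s U b)"

definition char_boundary :: "(plane \<Rightarrow> plane) \<Rightarrow> plane set \<Rightarrow> plane set \<Rightarrow> plane set" where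
  "char_boundary s U C = {x \<in> frontier C \<inter> frontier U. \<forall>z\<in>C. x \<notin> char_line s z}"

definition extended_field :: "(plane \<Rightarrow> plane) \<Rightarrow> plane set \<Rightarrow> plane set \<Rightarrow> plane \<Rightarrow> plane" where
  "extended_field s U C x =
     (if x \<in> (frontier C \<inter> frontier U) - char_boundary s U C
      then (THE v. \<exists>z\<in>C. x \<in> char_line s z \<and> v = s z)
      else s x)"

end

theory Submission
  imports Defs
begin

text \<open>Perturbing the minimizer by \<open>(t \<phi>, t \<nabla>\<phi>, 0)\<close> gives \<open>div \<sigma> = 0\<close>, so \<open>perp s\<close> is locally the gradient
  of a function \<open>\<psi>\<close> with \<open>|\<nabla>\<psi>| = 1\<close>. Such a \<open>\<psi>\<close> is 1-Lipschitz and grows with slope 1 along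
  some ray from each point, hence \<open>\<nabla>\<psi>\<close> is constant along this ray; this makes \<open>s\<close> constant on
  characteristic chords, and distinct chords disjoint.

  Of three disjoint chords one must separate the other two: otherwise, moving along a segment from
  the first to the second chord, the third one would change sides without being met. Hence all
  chords between two chords with a common end \<open>x\<close> pass through \<open>x\<close>, so such a sector belongs to a
  fan and the chord of \<open>\<^bold>C\<close> ending at \<open>x\<close> is unique. If \<open>x\<^sub>n \<rightarrow> x\<close> in \<open>\<^bold>C\<close> and \<open>s(x\<^sub>n) \<rightarrow> v\<close>, then the
  line through \<open>x\<close> normal to \<open>v\<close> either meets \<open>\<Omega>\<^sub>p\<close>, and uniqueness identifies \<open>v\<close>, or it supports
  \<open>\<Omega>\<^sub>p\<close>, and then the chord ending at \<open>x\<close> and two of the chords through the \<open>x\<^sub>n\<close> do not separate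
  each other.\<close>

section \<open>Geometry of the characteristic lines\<close>

text \<open>The obstacle is the boundary. The field has no limit there a priori, and a line can be
  based only at points of \<open>U\<close>, so every statement about a boundary point
  \<open>x\<close> is obtained from sign conditions that are tested inside \<open>U\<close> and
  survive a passage to the limit. The intermediate value theorem along segments takes the place of
  angular estimates; convexity of \<open>U\<close> provides the segments. A limit line that enters
  \<open>U\<close> contains an interior point at which \<open>s\<close> can be evaluated. A
  supporting line contains none, so there the relative position of three chords has to decide: any
  term of the sequence and any sufficiently late one must lie on opposite sides of the chord ending
  at \<open>x\<close>, and three terms cannot be pairwise opposite. On the analytic side
  characteristics are not followed as a flow. Constancy of the gradient comes from equality in the
  Lipschitz bound at a maximum point, and the potential is built from line integrals of a continuous
  field, with the weak equation tested on products of one-variable functions.\<close>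

lemma perp_nth [simp]: "perp z $ 1 = - (z $ 2)" "perp z $ 2 = z $ 1"
  by (simp_all add: perp_def)

lemma inner_plane: "x \<bullet> y = x $ 1 * y $ 1 + x $ 2 * y $ 2" for x y :: plane
  by (simp add: inner_vec_def sum_2)

lemma plane_eq_iff: "x = y \<longleftrightarrow> x $ 1 = y $ 1 \<and> x $ 2 = y $ 2" for x y :: plane
  by (simp add: vec_eq_iff forall_2)

lemma inner_perp_self [simp]: "perp z \<bullet> z = 0"
  by (simp add: inner_plane)

lemma norm_perp [simp]: "norm (perp z) = norm z"
  by (simp add: norm_eq_sqrt_inner inner_plane)

lemma bounded_linear_perp: "bounded_linear perp"
  by (rule linear_conv_bounded_linear[THEN iffD1], rule linearI) (simp_all add: plane_eq_iff)

lemmas tendsto_perp [tendsto_intros] = bounded_linear.tendsto[OF bounded_linear_perp]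

lemma eq_scaleR_perp:
  assumes "y \<bullet> v = 0" "norm v = 1"
  shows "y = (y \<bullet> perp v) *\<^sub>R perp v"
proof -
  have v: "v $ 1 * v $ 1 + v $ 2 * v $ 2 = 1"
    using assms(2) by (simp add: norm_eq_1 inner_plane)
  have o: "y $ 1 * v $ 1 + y $ 2 * v $ 2 = 0"
    using assms(1) by (simp add: inner_plane)
  have "y $ 1 = (y $ 2 * v $ 1 - y $ 1 * v $ 2) * - v $ 2" using v o by algebra
  moreover have "y $ 2 = (y $ 2 * v $ 1 - y $ 1 * v $ 2) * v $ 1" using v o by algebra
  ultimately show ?thesis by (simp add: plane_eq_iff inner_plane)
qed

lemma mem_char_line_iff:
  assumes "norm (s x) = 1"
  shows "y \<in> char_line s x \<longleftrightarrow> (y - x) \<bullet> s x = 0"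
proof
  assume "(y - x) \<bullet> s x = 0"
  from eq_scaleR_perp[OF this assms]
  have "y = x + ((y - x) \<bullet> perp (s x)) *\<^sub>R perp (s x)"
    by (simp add: algebra_simps)
  then show "y \<in> char_line s x" unfolding char_line_def by blast
qed (auto simp: char_line_def)

text \<open>The interface between analysis and geometry. Disjointness of distinct chords follows
  from \<open>const\<close>: at a common point of \<open>U\<close> both lines have the same normal,
  so they coincide.\<close>

locale char_foliation =
  fixes s :: "plane \<Rightarrow> plane" and U :: "plane set"
  assumes open_U: "open U" and convex_U: "convex U"
    and cont: "continuous_on U s"
    and unit: "x \<in> U \<Longrightarrow> norm (s x) = 1"
    and const: "x \<in> U \<Longrightarrow> y \<in> U \<Longrightarrow> y \<in> char_line s x \<Longrightarrow> s y = s x"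
begin

text \<open>The signed distance of \<open>b\<close> from the characteristic line of
  \<open>a\<close>, because \<open>s a\<close> is a unit normal of that line; the sign tells the
  side. The point \<open>b\<close> may lie on the boundary, the base point \<open>a\<close> may
  not.\<close>

definition dev :: "plane \<Rightarrow> plane \<Rightarrow> real" where
  "dev a b = (b - a) \<bullet> s a"

lemma mem_char_line: "a \<in> U \<Longrightarrow> b \<in> char_line s a \<longleftrightarrow> dev a b = 0"
  by (simp add: dev_def mem_char_line_iff unit)

lemma dev_eq_0E:
  assumes "a \<in> U" "dev a y = 0"
  obtains t where "y = a + t *\<^sub>R perp (s a)"
  using mem_char_line[OF assms(1), of y] assms(2) unfolding char_line_def by blast

lemma dev_eq_0D: "a \<in> U \<Longrightarrow> b \<in> U \<Longrightarrow> dev a b = 0 \<Longrightarrow> s b = s a"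
  using const mem_char_line by blast

text \<open>Points of one chord share the same oriented line, so the base point may be moved along
  its chord. This allows each chord to be tested from its most convenient point.\<close>

lemma dev_cong: "a \<in> U \<Longrightarrow> b \<in> U \<Longrightarrow> dev a b = 0 \<Longrightarrow> dev b c = dev a c"
  using dev_eq_0D[of a b] by (simp add: dev_def inner_diff_left)

lemma dev_sym: "a \<in> U \<Longrightarrow> b \<in> U \<Longrightarrow> dev a b = 0 \<longleftrightarrow> dev b a = 0"
  using dev_cong[of a b a] dev_cong[of b a b] by (auto simp: dev_def)

lemma seg_in: "a \<in> U \<Longrightarrow> b \<in> U \<Longrightarrow> 0 \<le> t \<Longrightarrow> t \<le> 1 \<Longrightarrow> a + t *\<^sub>R (b - a) \<in> U"
  using convexD_alt[OF convex_U, of a b t] by (simp add: algebra_simps)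

lemma dev_affine: "dev a (b + t *\<^sub>R (c - b)) = (1 - t) * dev a b + t * dev a c"
  by (simp add: dev_def algebra_simps inner_diff_left inner_add_left)

lemma dev_self [simp]: "dev a a = 0"
  by (simp add: dev_def)

section \<open>Signs along segments and the relative position of chords\<close>

lemma IVT_zero:
  fixes f :: "real \<Rightarrow> real"
  assumes "continuous_on {0..1} f" "f 0 * f 1 \<le> 0"
  obtains t where "0 \<le> t" "t \<le> 1" "f t = 0"
proof -
  consider "f 0 \<le> 0" "0 \<le> f 1" | "f 1 \<le> 0" "0 \<le> f 0"
    using assms(2) by (auto simp: mult_le_0_iff)
  then show ?thesis
  proof cases
    case 1 then show ?thesis using IVT'[of f 0 0 1] assms(1) that by auto
  next
    case 2 then show ?thesis using IVT2'[of f 1 0 0] assms(1) that by auto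
  qed
qed

text \<open>None of the three lines separates the other two: this cannot happen, because along the
  segment from \<open>a\<close> to \<open>b\<close> the side on which \<open>c\<close> lies would have to switch without \<open>c\<close> ever
  being met.\<close>

lemma no_tripod:
  assumes U: "a \<in> U" "b \<in> U" "c \<in> U"
    and a: "dev a b * dev a c > 0" and b: "dev b a * dev b c > 0" and c: "dev c a * dev c b > 0"
  shows False
proof -
  define q where "q t = a + t *\<^sub>R (b - a)" for t
  define f where "f t = (b - a) \<bullet> s (q t)" for t
  define g where "g t = dev (q t) c" for t
  have qU: "q t \<in> U" if "0 \<le> t" "t \<le> 1" for t
    using seg_in[OF U(1,2) that] by (simp add: q_def)
  have cs: "continuous_on {0..1} (\<lambda>t. s (q t))"
    by (rule continuous_on_compose2[OF cont]) (auto simp: q_def intro!: continuous_intros qU[unfolded q_def])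
  have cf: "continuous_on {0..1} f" unfolding f_def by (intro continuous_intros cs)
  have cg: "continuous_on {0..1} g" unfolding g_def dev_def
    by (intro continuous_intros cs) (auto simp: q_def intro!: continuous_intros)
  have da: "dev (q t) a = - t * f t" and db: "dev (q t) b = (1 - t) * f t" for t
    by (simp_all add: dev_def f_def q_def algebra_simps inner_diff_left inner_add_left)
  \<comment> \<open>A zero of \<open>f\<close> would put \<open>a\<close> and \<open>b\<close> on
    the chord of \<open>q t\<close>, hence both on one chord.\<close>
  have f0: "f t \<noteq> 0" if t: "0 \<le> t" "t \<le> 1" for t
  proof
    assume "f t = 0"
    then have "dev (q t) a = 0" "dev (q t) b = 0" using da db by auto
    then have "dev a b = 0" using dev_cong[OF qU[OF t] U(1), of b] by simp
    then show False using a by simp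
  qed
  have ff: "f 0 * f 1 > 0"
    by (rule ccontr) (metis IVT_zero[OF cf] f0 not_less)
  have "f 0 = dev a b" "g 0 = dev a c" "f 1 = - dev b a" "g 1 = dev b c"
    by (simp_all add: f_def g_def q_def dev_def algebra_simps inner_diff_left)
  \<comment> \<open>\<open>f\<close> keeps its sign, but \<open>b\<close> looks back at
    \<open>a\<close>: \<open>f 1\<close> is minus \<open>dev b a\<close>. By the first two sign
    hypotheses \<open>c\<close> is therefore on different sides at the two ends.\<close>
  then have "g 0 * g 1 \<le> 0" using a b ff by (auto simp: zero_less_mult_iff mult_le_0_iff mult_less_0_iff)
  from IVT_zero[OF cg this] obtain t where t: "0 \<le> t" "t \<le> 1" "g t = 0" by blast
  then have "dev c d = dev (q t) d" for d
    using dev_cong[OF qU[OF t(1,2)] U(3), of d] by (simp add: g_def)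
  then have "dev c a = dev (q t) a" "dev c b = dev (q t) b" by blast+
  \<comment> \<open>At the crossing \<open>c\<close> lies on the chord of \<open>q t\<close>, and
    \<open>q t\<close> is between \<open>a\<close> and \<open>b\<close>, so this chord separates
    them.\<close>
  then have "dev c a * dev c b = - (t * (1 - t) * (f t)\<^sup>2)"
    unfolding \<open>dev c a = dev (q t) a\<close> \<open>dev c b = dev (q t) b\<close> da db
    by (simp add: power2_eq_square)
  also have "\<dots> \<le> 0" using t by simp
  finally show False using c by simp
qed

lemma toward_boundary_in:
  assumes "x \<in> closure U" "a \<in> U" "0 < t" "t \<le> 1"
  shows "x + t *\<^sub>R (a - x) \<in> U"
proof (cases "x = a")
  case False
  have "a - (1 - t) *\<^sub>R (a - x) \<in> interior U"
  proof (cases "t = 1")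
    case True then show ?thesis using assms(2) interior_open[OF open_U] by simp
  next
    case f: False
    show ?thesis
      using mem_interior_closure_convex_shrink[OF convex_U, of a x t] assms interior_open[OF open_U]
      by (simp add: algebra_simps)
  qed
  then show ?thesis using interior_open[OF open_U] by (simp add: algebra_simps)
qed (use assms in simp)

text \<open>Between two lines with a common boundary point \<open>x\<close> every line passes through \<open>x\<close>: it has to
  separate the two lines, however close to \<open>x\<close> these are tested.\<close>

lemma sector_through_apex:
  assumes U: "a \<in> U" "b \<in> U" "c \<in> U" and x: "x \<in> closure U" "dev a x = 0" "dev b x = 0"
    and a: "dev a b * dev a c > 0" and b: "dev b a * dev b c > 0"
  shows "dev c x = 0"
proof -
  define A where "A t = x + t *\<^sub>R (a - x)" for t
  define B where "B t = x + t *\<^sub>R (b - x)" for t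
  have le: "dev c (A t) * dev c (B t) \<le> 0" if t: "0 < t" "t \<le> 1" for t
  proof (rule ccontr)
    assume n: "\<not> dev c (A t) * dev c (B t) \<le> 0"
    have AB: "A t \<in> U" "B t \<in> U"
      using toward_boundary_in[OF x(1)] U t by (auto simp: A_def B_def)
    have "dev a (A t) = 0" "dev b (B t) = 0"
      using x by (simp_all add: A_def B_def dev_affine)
    then have dA: "dev (A t) d = dev a d" and dB: "dev (B t) d = dev b d" for d
      using dev_cong[OF U(1) AB(1), of d] dev_cong[OF U(2) AB(2), of d] by blast+
    \<comment> \<open>Both lines contain \<open>x\<close>, so shrinking towards \<open>x\<close>
      merely scales these deviations by \<open>t\<close> and preserves their signs.\<close>
    have "dev a (B t) = t * dev a b" "dev b (A t) = t * dev b a"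
      using x by (simp_all add: A_def B_def dev_affine)
    then have "dev (A t) (B t) * dev (A t) c > 0" "dev (B t) (A t) * dev (B t) c > 0"
      using a b t by (simp_all add: dA dB mult.assoc)
    then show False using no_tripod[OF AB U(3)] n by auto
  qed
  have "((\<lambda>t. dev c (A t) * dev c (B t)) \<longlongrightarrow> dev c (A 0) * dev c (B 0)) (at_right 0)"
    unfolding A_def B_def dev_def by (intro tendsto_intros)
  moreover have "eventually (\<lambda>t. dev c (A t) * dev c (B t) \<le> 0) (at_right (0::real))"
    using le by (intro eventually_at_rightI[of 0 1]) auto
  \<comment> \<open>At \<open>t = 0\<close> both test points are \<open>x\<close>, so this says that
    the square of \<open>dev c x\<close> is at most zero.\<close>
  ultimately have "dev c (A 0) * dev c (B 0) \<le> 0"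
    by (rule tendsto_upperbound) auto
  then show ?thesis by (simp add: A_def B_def) (auto simp: mult_le_0_iff)
qed

text \<open>If \<open>c\<close> were beyond \<open>a\<close> as seen from \<open>b\<close> and
  beyond \<open>b\<close> as seen from \<open>a\<close>, the two chords would cross in
  \<open>U\<close>. The segment from \<open>c\<close> to \<open>b\<close> meets the line of
  \<open>a\<close> at \<open>q\<close>, still beyond \<open>b\<close>; hence the segment from
  \<open>a\<close> to \<open>q\<close>, which runs along the chord of \<open>a\<close>, meets the
  line of \<open>b\<close>.\<close>

lemma opposite_sides_disjoint:
  assumes U: "a \<in> U" "b \<in> U" "c \<in> U" and ab: "dev a b \<noteq> 0"
    and a: "dev a b * dev a c \<le> 0" and b: "dev b a * dev b c \<le> 0"
  shows False
proof -
  have "continuous_on {0..1} (\<lambda>t. dev a (c + t *\<^sub>R (b - c)))"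
    unfolding dev_def by (intro continuous_intros)
  from IVT_zero[OF this] obtain t where t: "0 \<le> t" "t \<le> 1" "dev a (c + t *\<^sub>R (b - c)) = 0"
    using a by (auto simp: mult.commute)
  define q where "q = c + t *\<^sub>R (b - c)"
  have q: "q \<in> U" "dev a q = 0" using t seg_in U by (auto simp: q_def)
  have "dev b q = (1 - t) * dev b c" by (simp add: q_def dev_affine)
  then have "dev b a * dev b q \<le> 0" using b t
    by (metis diff_ge_0_iff_ge mult.left_commute mult_nonneg_nonpos)
  moreover have "continuous_on {0..1} (\<lambda>t. dev b (a + t *\<^sub>R (q - a)))"
    unfolding dev_def by (intro continuous_intros)
  ultimately obtain r where r: "0 \<le> r" "r \<le> 1" "dev b (a + r *\<^sub>R (q - a)) = 0"
    using IVT_zero[of "\<lambda>t. dev b (a + t *\<^sub>R (q - a))"] by auto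
  define p where "p = a + r *\<^sub>R (q - a)"
  have p: "p \<in> U" "dev b p = 0" using r seg_in U q by (auto simp: p_def)
  have "dev a p = 0" using q by (simp add: p_def dev_affine)
  then have "dev a b = dev p b" using dev_cong[OF U(1) p(1), of b] by simp
  also have "\<dots> = 0" using dev_cong[OF U(2) p, of b] by simp
  finally show False using ab by simp
qed

text \<open>Two different chords of \<open>C\<close> ending at \<open>x\<close> make
  \<open>x\<close> an apex, and its fan contains the open sector \<open>W\<close> between them.
  Without \<open>W\<close>, the set \<open>C\<close> splits into a part beyond \<open>a\<close> and
  a part beyond \<open>b\<close>. Both are relatively closed, and they are disjoint by
  \<open>opposite_sides_disjoint\<close>, against connectedness.\<close>

lemma unique_line_through:
  assumes C: "connected C" "C \<subseteq> fan_complement s U" and ab: "a \<in> C" "b \<in> C"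
    and x: "x \<in> frontier U" "dev a x = 0" "dev b x = 0"
  shows "s a = s b"
proof (rule ccontr)
  assume ne: "s a \<noteq> s b"
  have U: "a \<in> U" "b \<in> U" using C ab by (auto simp: fan_complement_def)
  have dab: "dev a b \<noteq> 0" "dev b a \<noteq> 0" using dev_eq_0D U ne dev_sym by metis+
  \<comment> \<open>\<open>fan_apexes\<close> demands that the lines meet in exactly one point.
    Parallel lines through the common point \<open>x\<close> would coincide, against
    \<open>dab\<close>.\<close>
  have "y = x" if y0: "dev a y = 0" "dev b y = 0" for y
  proof -
    obtain t where y: "y = a + t *\<^sub>R perp (s a)"
      using dev_eq_0E[OF U(1) y0(1)] .
    obtain t' where x': "x = a + t' *\<^sub>R perp (s a)"
      using dev_eq_0E[OF U(1) x(2)] .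
    have "(t - t') * (perp (s a) \<bullet> s b) = dev b y - dev b x"
      by (simp add: dev_def y x' algebra_simps inner_add_left inner_diff_left)
    then have "t = t' \<or> perp (s a) \<bullet> s b = 0" using y0 x by auto
    moreover have "perp (s a) \<bullet> s b \<noteq> 0"
    proof
      assume "perp (s a) \<bullet> s b = 0"
      then have "dev b a = dev b x" by (simp add: dev_def x' inner_add_left inner_diff_left)
      then show False using x dab by simp
    qed
    ultimately show ?thesis by (simp add: y x')
  qed
  then have "char_line s a \<inter> char_line s b = {x}"
    using x mem_char_line[OF U(1)] mem_char_line[OF U(2)] by blast
  moreover have "a \<noteq> b" using ne by auto
  ultimately have ax: "x \<in> fan_apexes s U" using x(1) U unfolding fan_apexes_def by blast
  define W where "W = U \<inter> ({c. dev a b * dev a c > 0} \<inter> {c. dev b a * dev b c > 0})"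
  have "open W" unfolding W_def dev_def
    by (intro open_Int open_U open_Collect_less continuous_intros)
  moreover have "W \<subseteq> {z \<in> U. x \<in> char_line s z}"
    using sector_through_apex[OF U] x by (auto simp: W_def frontier_def mem_char_line)
  ultimately have "W \<subseteq> fan s U x" unfolding fan_def by (rule interior_maximal[rotated])
  then have CW: "C \<inter> W = {}" using C(2) ax by (auto simp: fan_complement_def)
  define A where "A = {c. dev a b * dev a c \<le> 0}"
  define B where "B = {c. dev b a * dev b c \<le> 0}"
  have "closed A" "closed B" unfolding A_def B_def dev_def
    by (intro closed_Collect_le continuous_intros)+
  moreover have "C \<subseteq> A \<union> B" using CW C(2) by (force simp: A_def B_def W_def fan_complement_def)
  moreover have "A \<inter> B \<inter> C = {}" using opposite_sides_disjoint[OF U _ dab(1)] C(2)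
    by (auto simp: A_def B_def fan_complement_def)
  moreover have "a \<in> A" "b \<in> B" by (auto simp: A_def B_def)
  ultimately show False using C(1) ab unfolding connected_closed by blast
qed

text \<open>A fan is an interior, so a whole neighbourhood has to be moved along the chords. The map
  \<open>T\<close>, which slides every point by the same length \<open>t\<close> along its own
  chord, is continuous and takes \<open>y\<close> to \<open>z\<close>; the preimage of the fan is
  open and consists of points whose lines pass through \<open>x\<close>.\<close>

lemma fan_saturated:
  assumes z: "z \<in> fan s U x" and y: "y \<in> U" "dev z y = 0"
  shows "y \<in> fan s U x"
proof -
  have zU: "z \<in> U" using z interior_subset by (auto simp: fan_def)
  then have "dev y z = 0" using y dev_sym by simp
  then obtain t where t: "z = y + t *\<^sub>R perp (s y)"
    using dev_eq_0E[OF y(1)] by blast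
  define T where "T y = y + t *\<^sub>R perp (s y)" for y
  have cT: "continuous_on U T" unfolding T_def
    by (intro continuous_intros cont bounded_linear.continuous_on[OF bounded_linear_perp])
  have oV: "open (U \<inter> T -` fan s U x)"
    using continuous_open_preimage[OF cT open_U] by (simp add: fan_def)
  have "U \<inter> T -` fan s U x \<subseteq> {z \<in> U. x \<in> char_line s z}"
  proof
    fix w assume w: "w \<in> U \<inter> T -` fan s U x"
    then have "T w \<in> U" "dev (T w) x = 0"
      using interior_subset[of "{z \<in> U. x \<in> char_line s z}"] mem_char_line by (auto simp: fan_def)
    moreover have "dev w (T w) = 0" by (simp add: dev_def T_def)
    ultimately show "w \<in> {z \<in> U. x \<in> char_line s z}"
      using dev_cong[of w "T w" x] w by (simp add: mem_char_line)
  qed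
  with oV have "U \<inter> T -` fan s U x \<subseteq> fan s U x"
    unfolding fan_def by (rule interior_maximal[rotated])
  then show ?thesis using y z t by (auto simp: T_def)
qed

section \<open>The closure of a single component of the fan complement\<close>

context
  fixes C assumes C: "C \<in> components (fan_complement s U)"
begin

lemma C_sub: "C \<subseteq> fan_complement s U" and C_conn: "connected C" and C_U: "C \<subseteq> U"
  using C in_components_subset in_components_connected by (auto simp: fan_complement_def)

text \<open>Fans are open, so their complement is closed relative to \<open>U\<close>, and its
  components inherit this.\<close>

lemma closure_C: "closure C \<inter> U \<subseteq> C"
proof -
  have "open (\<Union>b\<in>fan_apexes s U. fan s U b)" by (auto simp: fan_def)
  then have "closedin (top_of_set U) (fan_complement s U)"
    unfolding fan_complement_def by (auto simp: closedin_closed Diff_eq)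
  then have "closedin (top_of_set U) C"
    using C closedin_component closedin_trans by blast
  then show ?thesis unfolding closedin_closed
    by (metis Int_commute Int_mono closure_minimal inf_le2 subset_refl)
qed

text \<open>If a point of the chord lay in a fan, then by saturation so would \<open>z\<close>.
  Hence the chord avoids all fans and, being connected, stays in the component of
  \<open>z\<close>.\<close>

lemma line_in_C:
  assumes "z \<in> C" "y \<in> U" "dev z y = 0"
  shows "y \<in> C"
proof -
  have zU: "z \<in> U" using assms C_U by blast
  have sub: "closed_segment z y \<subseteq> fan_complement s U"
  proof
    fix q assume q: "q \<in> closed_segment z y"
    then have qU: "q \<in> U" using convex_U zU assms(2) convex_contains_segment by blast
    obtain t where "q = z + t *\<^sub>R (y - z)"
      using q by (auto simp: closed_segment_def algebra_simps)
    then have "dev z q = 0" using assms(3) by (simp add: dev_affine)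
    then have "dev q z = 0" using dev_sym zU qU by blast
    then have "q \<notin> fan s U b" if "b \<in> fan_apexes s U" for b
      using fan_saturated[of q b z] zU assms(1) C_sub that by (auto simp: fan_complement_def)
    then show "q \<in> fan_complement s U" using qU by (auto simp: fan_complement_def)
  qed
  have "closed_segment z y \<subseteq> C"
    by (rule components_maximal[OF C _ sub]) (use assms(1) in auto)
  then show ?thesis by auto
qed

lemma continuous_at_end:
  assumes x: "x \<in> frontier U" and z: "z \<in> C" "dev z x = 0"
    and X: "\<And>n. X n \<in> C" "X \<longlonglongrightarrow> x" and lim: "(\<lambda>n. s (X n)) \<longlonglongrightarrow> v"
  shows "v = s z"
proof (rule ccontr)
  assume vz: "v \<noteq> s z"
  have zU: "z \<in> U" and XU: "X n \<in> U" for n using C_U z X by blast+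
  have nv: "norm v = 1"
    using tendsto_norm[OF lim] unit[OF XU] by (simp add: LIMSEQ_const_iff)
  show False
  proof (cases "\<exists>y\<in>U. (y - x) \<bullet> v = 0")
    case True
    then obtain y where y: "y \<in> U" "(y - x) \<bullet> v = 0" by blast
    define t where "t = (y - x) \<bullet> perp v"
    have yt: "y = x + t *\<^sub>R perp v"
      using eq_scaleR_perp[OF y(2) nv] unfolding t_def by (simp only: diff_eq_eq add.commute)
    \<comment> \<open>Each \<open>X n\<close> slides along its own chord by the fixed length
      \<open>t\<close>, so that the sequence reaches the interior point \<open>y\<close>. Continuity
      there gives \<open>s y = v\<close>, and \<open>y\<close> is a point of \<open>C\<close> whose
      line ends at \<open>x\<close>.\<close>
    define Y where "Y n = X n + t *\<^sub>R perp (s (X n))" for n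
    have Y: "Y \<longlonglongrightarrow> y" unfolding Y_def yt by (intro tendsto_intros X lim)
    then have ev: "eventually (\<lambda>n. Y n \<in> U) sequentially"
      using open_U y(1) topological_tendstoD by blast
    have d: "dev (X n) (Y n) = 0" for n by (simp add: dev_def Y_def)
    have "(\<lambda>n. s (Y n)) \<longlonglongrightarrow> s y"
      using continuous_on_tendsto_compose[OF cont Y y(1) ev] .
    moreover have "eventually (\<lambda>n. s (Y n) = s (X n)) sequentially"
      using ev by eventually_elim (use dev_eq_0D XU d in blast)
    ultimately have "(\<lambda>n. s (X n)) \<longlonglongrightarrow> s y" using tendsto_cong by fast
    then have sy: "s y = v" using lim LIMSEQ_unique by blast
    have "eventually (\<lambda>n. Y n \<in> C) sequentially"
      using ev by eventually_elim (use line_in_C X d in blast)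
    then have "y \<in> closure C"
      by (intro Lim_in_closed_set[OF closed_closure _ sequentially_bot Y])
        (auto elim!: eventually_mono intro: closure_subset[THEN subsetD])
    then have "y \<in> C" using closure_C y by blast
    moreover have "dev y x = 0" using y sy by (simp add: dev_def inner_diff_left)
    ultimately have "s y = s z" using unique_line_through[OF C_conn C_sub] z x by blast
    then show False using sy vz by simp
  next
    case False
    \<comment> \<open>The limit line misses \<open>U\<close>, so the convex set \<open>U\<close>
      lies strictly on one side of it.\<close>
    have same: "((a - x) \<bullet> v) * ((b - x) \<bullet> v) > 0" if "a \<in> U" "b \<in> U" for a b
    proof (rule ccontr)
      assume "\<not> ?thesis"
      moreover have "continuous_on {0..1} (\<lambda>t. (a + t *\<^sub>R (b - a) - x) \<bullet> v)"
        by (intro continuous_intros)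
      ultimately obtain t where "0 \<le> t" "t \<le> 1" "(a + t *\<^sub>R (b - a) - x) \<bullet> v = 0"
        using IVT_zero[of "\<lambda>t. (a + t *\<^sub>R (b - a) - x) \<bullet> v"] by auto
      then show False using False seg_in[OF that] by blast
    qed
    have "eventually (\<lambda>n. s (X n) \<noteq> s z) sequentially"
      using tendsto_imp_eventually_ne[OF lim vz] .
    then obtain N where N: "\<And>n. n \<ge> N \<Longrightarrow> s (X n) \<noteq> s z"
      by (auto simp: eventually_sequentially)
    have nx: "dev (X n) x \<noteq> 0" if "n \<ge> N" for n
      using unique_line_through[OF C_conn C_sub X(1) z(1) x _ z(2)] N[OF that] by blast
    have nz: "dev z (X n) \<noteq> 0" if "n \<ge> N" for n
      using dev_eq_0D[OF zU XU] N[OF that] by blast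
    \<comment> \<open>For late \<open>m\<close> the chord of \<open>X m\<close> leaves
      \<open>z\<close> and \<open>X n\<close> on one side, and the chord of \<open>X n\<close>
      leaves \<open>z\<close> and \<open>X m\<close> on one side. By \<open>no_tripod\<close> the
      chord of \<open>z\<close> cannot leave \<open>X n\<close> and \<open>X m\<close> on one side
      as well.\<close>
    have ev2: "eventually (\<lambda>m. \<not> dev z (X n) * dev z (X m) > 0) sequentially" if n: "n \<ge> N" for n
    proof -
      \<comment> \<open>The lines of \<open>X m\<close> approach the supporting line, which has all
        of \<open>U\<close> on one side.\<close>
      have e1: "eventually (\<lambda>m. dev (X m) a * dev (X m) b > 0) sequentially"
        if "a \<in> U" "b \<in> U" for a b
      proof -
        have "(\<lambda>m. dev (X m) a * dev (X m) b) \<longlonglongrightarrow> ((a - x) \<bullet> v) * ((b - x) \<bullet> v)"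
          unfolding dev_def by (intro tendsto_intros X lim)
        then show ?thesis using same[OF that] order_tendstoD(1) by blast
      qed
      \<comment> \<open>Between \<open>x\<close> and \<open>z\<close> the chord of \<open>z\<close>
        cannot cross the chord of \<open>X n\<close>, on which \<open>s\<close> has another value;
        so \<open>x\<close> and \<open>z\<close> are on the same side, and with \<open>x\<close> the
        late \<open>X m\<close>.\<close>
      have pos: "dev (X n) z * dev (X n) x > 0"
      proof (rule ccontr)
        assume "\<not> ?thesis"
        moreover have "continuous_on {0..1} (\<lambda>t. dev (X n) (x + t *\<^sub>R (z - x)))"
          unfolding dev_def by (intro continuous_intros)
        ultimately obtain t where t: "0 \<le> t" "t \<le> 1" "dev (X n) (x + t *\<^sub>R (z - x)) = 0"
          using IVT_zero[of "\<lambda>t. dev (X n) (x + t *\<^sub>R (z - x))"] by (auto simp: mult.commute)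
        define q where "q = x + t *\<^sub>R (z - x)"
        have "t \<noteq> 0" using t nx[OF n] by auto
        then have "q \<in> U" unfolding q_def
          using toward_boundary_in[of x z t] zU t x by (auto simp: frontier_def)
        moreover have "dev z q = 0" using z by (simp add: q_def dev_affine)
        ultimately have "s q = s z" "s q = s (X n)"
          using dev_eq_0D zU XU t(3) unfolding q_def by blast+
        then show False using N[OF n] by simp
      qed
      have "(\<lambda>m. dev (X n) z * dev (X n) (X m)) \<longlonglongrightarrow> dev (X n) z * dev (X n) x"
        unfolding dev_def by (intro tendsto_intros X)
      then have e2: "eventually (\<lambda>m. dev (X n) z * dev (X n) (X m) > 0) sequentially"
        using pos order_tendstoD(1) by blast
      show ?thesis
        using e1[OF zU XU[of n]] e2
        by eventually_elim (use no_tripod[OF zU XU[of n] XU] in blast)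
    qed
    \<comment> \<open>\<open>P\<close> records the side of the chord of \<open>z\<close>. Relative
      to any index from \<open>N\<close> on, all late terms are on the other side; \<open>N\<close>,
      \<open>M\<close> and one later index would be pairwise opposite, but there are only two
      sides.\<close>
    define P where "P n \<longleftrightarrow> dev z (X n) > 0" for n
    have flip: "eventually (\<lambda>m. P m \<longleftrightarrow> \<not> P n) sequentially" if "n \<ge> N" for n
      using ev2[OF that] eventually_ge_at_top[of N]
    proof eventually_elim
      case (elim m)
      then show ?case using nz[of m] nz[OF that] unfolding P_def zero_less_mult_iff by linarith
    qed
    have "eventually (\<lambda>m. P m \<longleftrightarrow> \<not> P N) sequentially" by (rule flip) simp
    then obtain M0 where M0: "\<And>m. m \<ge> M0 \<Longrightarrow> P m \<longleftrightarrow> \<not> P N"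
      unfolding eventually_sequentially by blast
    define M where "M = max N M0"
    have M: "M \<ge> N" and "M \<ge> M0" by (simp_all add: M_def)
    from \<open>M \<ge> M0\<close> have PM: "P m \<longleftrightarrow> \<not> P N" if "m \<ge> M" for m
      by (intro M0) (use that in linarith)
    have "eventually (\<lambda>m. P m \<longleftrightarrow> \<not> P M) sequentially" by (rule flip[OF M])
    then obtain K where "\<And>m. m \<ge> K \<Longrightarrow> P m \<longleftrightarrow> \<not> P M"
      unfolding eventually_sequentially by blast
    from this[of "max K M"] PM[of "max K M"] PM[of M] show False by linarith
  qed
qed

text \<open>Convergence of the values along a sequence need not be assumed: they lie on the unit
  circle, so a subsequence converges, and \<open>continuous_at_end\<close> identifies its
  limit.\<close>

lemma continuous_at_end_eps:
  assumes x: "x \<in> frontier U" and z: "z \<in> C" "dev z x = 0" and e: "e > 0"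
  obtains d where "d > 0" "\<And>y. y \<in> C \<Longrightarrow> dist y x < d \<Longrightarrow> dist (s y) (s z) < e"
proof (rule ccontr)
  assume "\<not> thesis"
  then have "\<forall>n. \<exists>y\<in>C. dist y x < inverse (real (Suc n)) \<and> \<not> dist (s y) (s z) < e"
    using that by (metis inverse_positive_iff_positive of_nat_0_less_iff zero_less_Suc)
  then obtain X where X: "\<And>n. X n \<in> C" "\<And>n. dist (X n) x < inverse (real (Suc n))"
    and ge: "\<And>n. \<not> dist (s (X n)) (s z) < e" by metis
  have "(\<lambda>n. dist (X n) x) \<longlonglongrightarrow> 0"
    by (rule real_tendsto_sandwich[OF _ _ tendsto_const LIMSEQ_inverse_real_of_nat])
      (use less_imp_le[OF X(2)] in \<open>simp_all add: eventuallyI\<close>)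
  then have Xx: "X \<longlonglongrightarrow> x" by (rule tendsto_dist_iff[THEN iffD2])
  have "s (X n) \<in> sphere 0 1" for n by (simp add: unit subsetD[OF C_U X(1)])
  then obtain v r where r: "strict_mono r" "((\<lambda>n. s (X n)) \<circ> r) \<longlonglongrightarrow> v"
    using compact_imp_seq_compact[OF compact_sphere, of "0::plane" 1]
    by (rule_tac seq_compactE[of "sphere 0 1" "\<lambda>n. s (X n)"]) auto
  have "v = s z"
    by (rule continuous_at_end[OF x z, of "X \<circ> r"])
      (use X(1) r LIMSEQ_subseq_LIMSEQ[OF Xx r(1)] in \<open>auto simp: o_def\<close>)
  then have "(\<lambda>n. dist (s (X (r n))) (s z)) \<longlonglongrightarrow> 0"
    using tendsto_dist_iff[THEN iffD1, OF r(2)] by (simp add: o_def)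
  then have "eventually (\<lambda>n. dist (s (X (r n))) (s z) < e) sequentially"
    using order_tendstoD(2) e by blast
  then show False using ge by (auto simp: eventually_sequentially)
qed

text \<open>By \<open>unique_line_through\<close> all chords of \<open>C\<close> that end at
  \<open>x\<close> carry the same value, so the definite description is meaningful.\<close>

lemma extended_field_end:
  assumes x: "x \<in> frontier C" "x \<in> frontier U" and z: "z \<in> C" "dev z x = 0"
  shows "extended_field s U C x = s z"
proof -
  have zx: "x \<in> char_line s z" using z C_U mem_char_line by blast
  then have "x \<notin> char_boundary s U C" using z by (auto simp: char_boundary_def)
  moreover have "(THE v. \<exists>z\<in>C. x \<in> char_line s z \<and> v = s z) = s z"
  proof (rule the_equality)
    fix v assume "\<exists>z\<in>C. x \<in> char_line s z \<and> v = s z"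
    then obtain z' where "z' \<in> C" "x \<in> char_line s z'" "v = s z'" by blast
    then show "v = s z"
      using unique_line_through[OF C_conn C_sub _ z(1) x(2) _ z(2)] C_U mem_char_line by blast
  qed (use z zx in blast)
  ultimately show ?thesis using x by (simp add: extended_field_def)
qed

lemma extended_field_U: "x \<in> U \<Longrightarrow> extended_field s U C x = s x"
  using open_U by (simp add: extended_field_def frontier_def interior_open)

text \<open>Values at neighbouring boundary points have to be compared too. Such a point is moved
  slightly into \<open>C\<close> along its chord, where the field has the same value, so the
  estimate for points of \<open>C\<close> suffices.\<close>

theorem continuous_on_extended_field:
  "continuous_on (closure C - char_boundary s U C) (extended_field s U C)"
  unfolding continuous_on_iff
proof (intro ballI allI impI)
  fix x e assume x: "x \<in> closure C - char_boundary s U C" and e: "(0::real) < e"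
  let ?f = "extended_field s U C"
  have end_line: "y \<in> frontier U \<and> y \<in> frontier C \<and> (\<exists>z\<in>C. dev z y = 0)"
    if "y \<in> closure C - char_boundary s U C" "y \<notin> U" for y
  proof -
    have "y \<in> frontier U" using that open_U C_U closure_mono[of C U]
      by (auto simp: frontier_def interior_open)
    moreover have "y \<in> frontier C" using that C_U interior_subset[of C] by (auto simp: frontier_def)
    ultimately show ?thesis using that C_U mem_char_line by (auto simp: char_boundary_def)
  qed
  show "\<exists>d>0. \<forall>x'\<in>closure C - char_boundary s U C. dist x' x < d \<longrightarrow> dist (?f x') (?f x) < e"
  proof (cases "x \<in> U")
    case True
    obtain r where r: "r > 0" "ball x r \<subseteq> U" using True open_U open_contains_ball by blast
    obtain d where d: "d > 0" "\<And>y. y \<in> U \<Longrightarrow> dist y x < d \<Longrightarrow> dist (s y) (s x) < e"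
      using cont True e unfolding continuous_on_iff by metis
    show ?thesis
    proof (intro exI[of _ "min r d"] conjI ballI impI)
      fix y assume y: "dist y x < min r d"
      then have "y \<in> U" using r by (auto simp: dist_commute)
      then show "dist (?f y) (?f x) < e" using y True d by (simp add: extended_field_U)
    qed (use r d in auto)
  next
    case False
    obtain z where xf: "x \<in> frontier U" "x \<in> frontier C" and z: "z \<in> C" "dev z x = 0"
      using end_line[OF x False] by blast
    have fx: "?f x = s z" using extended_field_end xf z by blast
    obtain d where d: "d > 0" "\<And>y. y \<in> C \<Longrightarrow> dist y x < d \<Longrightarrow> dist (s y) (s z) < e"
      using continuous_at_end_eps[OF xf(1) z e] by blast
    show ?thesis
    proof (intro exI[of _ d] conjI ballI impI)
      fix y assume y: "y \<in> closure C - char_boundary s U C" "dist y x < d"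
      show "dist (?f y) (?f x) < e"
      proof (cases "y \<in> U")
        case True
        then show ?thesis using y d closure_C fx by (auto simp: extended_field_U)
      next
        case yU: False
        obtain z' where yf: "y \<in> frontier U" "y \<in> frontier C" and z': "z' \<in> C" "dev z' y = 0"
          using end_line[OF y(1) yU] by blast
        have "((\<lambda>t. dist (y + t *\<^sub>R (z' - y)) x) \<longlongrightarrow> dist (y + 0 *\<^sub>R (z' - y)) x) (at_right 0)"
          by (intro tendsto_intros)
        then have "eventually (\<lambda>t. dist (y + t *\<^sub>R (z' - y)) x < d) (at_right 0)"
          using y(2) order_tendstoD(2) by fastforce
        moreover have "eventually (\<lambda>t. t \<in> {0<..<1}) (at_right (0::real))"
          by (rule eventually_at_right_real) simp
        ultimately have "eventually (\<lambda>t. dist (y + t *\<^sub>R (z' - y)) x < d \<and> t \<in> {0<..<1}) (at_right (0::real))"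
          by (rule eventually_conj)
        then obtain t where t: "dist (y + t *\<^sub>R (z' - y)) x < d" "0 < t" "t < 1"
          using eventually_happens by fastforce
        define q where "q = y + t *\<^sub>R (z' - y)"
        have q: "q \<in> U" unfolding q_def
          by (rule toward_boundary_in) (use yf t z' C_U in \<open>auto simp: frontier_def\<close>)
        have dq: "dev z' q = 0" using z' by (simp add: q_def dev_affine)
        then have "q \<in> C" "s q = s z'" using line_in_C dev_eq_0D z' q C_U by blast+
        then show ?thesis using d(2)[of q] t extended_field_end[OF yf(2,1) z'] fx
          by (simp add: q_def)
      qed
    qed (use d in auto)
  qed
qed

end
end

section \<open>Differentiable solutions of the eikonal equation\<close>

lemma eikonal_lipschitz:
  fixes \<psi> :: "'a::real_inner \<Rightarrow> real"
  assumes der: "\<And>x. x \<in> ball x0 r \<Longrightarrow> (\<psi> has_derivative (\<lambda>h. G x \<bullet> h)) (at x)"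
    and unit: "\<And>x. x \<in> ball x0 r \<Longrightarrow> norm (G x) = 1"
    and ab: "a \<in> ball x0 r" "b \<in> ball x0 r"
  shows "\<psi> a - \<psi> b \<le> norm (a - b)"
proof -
  have "onorm (\<lambda>h. G x \<bullet> h) \<le> 1" if "x \<in> ball x0 r" for x
    using Cauchy_Schwarz_ineq2[of "G x"] unit[OF that] by (intro onorm_bound) auto
  then have "norm (\<psi> a - \<psi> b) \<le> 1 * norm (a - b)"
    by (intro differentiable_bound[of "ball x0 r" \<psi> "\<lambda>x h. G x \<bullet> h"] ab
        has_derivative_at_withinI[OF der] convex_ball)
  then show ?thesis by simp
qed

lemma has_real_derivative_along_line:
  fixes \<psi> :: "'a::real_inner \<Rightarrow> real"
  assumes "(\<psi> has_derivative (\<lambda>h. G \<bullet> h)) (at (x + t *\<^sub>R e))"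
  shows "((\<lambda>t. \<psi> (x + t *\<^sub>R e)) has_real_derivative G \<bullet> e) (at t)"
proof -
  have "((\<lambda>t. x + t *\<^sub>R e) has_derivative (\<lambda>h. h *\<^sub>R e)) (at t)"
    by (auto intro!: derivative_eq_intros)
  from has_derivative_compose[OF this assms] show ?thesis
    by (simp add: has_field_derivative_def mult_commute_abs)
qed

text \<open>A maximum point of \<open>\<psi> - (1 - \<epsilon>)|\<cdot> - x0|\<close> cannot lie inside the ball, since \<open>\<psi>\<close> grows
  with slope 1 in the direction of its gradient.\<close>

lemma eikonal_growth:
  fixes \<psi> :: "plane \<Rightarrow> real"
  assumes der: "\<And>x. x \<in> ball x0 r \<Longrightarrow> (\<psi> has_derivative (\<lambda>h. G x \<bullet> h)) (at x)"
    and unit: "\<And>x. x \<in> ball x0 r \<Longrightarrow> norm (G x) = 1"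
    and \<rho>: "0 < \<rho>" "\<rho> < r" and \<epsilon>: "0 < \<epsilon>" "\<epsilon> < 1"
  shows "\<exists>w\<in>cball x0 \<rho>. \<psi> w \<ge> \<psi> x0 + (1 - \<epsilon>) * \<rho>"
proof -
  have sub: "cball x0 \<rho> \<subseteq> ball x0 r" using \<rho> by auto
  have c: "continuous_on (cball x0 \<rho>) \<psi>"
    by (intro continuous_at_imp_continuous_on ballI has_derivative_continuous[OF der])
      (use sub in blast)
  define g where "g z = \<psi> z - (1 - \<epsilon>) * norm (z - x0)" for z
  have "continuous_on (cball x0 \<rho>) g" unfolding g_def by (intro continuous_intros c)
  then obtain w where w: "w \<in> cball x0 \<rho>" and max: "\<And>z. z \<in> cball x0 \<rho> \<Longrightarrow> g z \<le> g w"
    using continuous_attains_sup[of "cball x0 \<rho>" g] \<rho> by auto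
  have "norm (w - x0) = \<rho>"
  proof (rule ccontr)
    assume "norm (w - x0) \<noteq> \<rho>"
    then have lt: "norm (w - x0) < \<rho>" using w by (auto simp: dist_norm norm_minus_commute)
    have wb: "w \<in> ball x0 r" using w sub by blast
    \<comment> \<open>Along the gradient \<psi> rises at rate 1, while the distance to
      \<open>x0\<close> costs at most \<open>1 - \<epsilon>\<close> per unit length. The net rate
      \<epsilon> is positive, which is why the slope was lowered from 1.\<close>
    define f where "f t = \<psi> (w + t *\<^sub>R G w) - (1 - \<epsilon>) * t" for t
    have "G w \<bullet> G w = 1" using unit[OF wb] by (simp add: norm_eq_1)
    moreover have "((\<lambda>t. \<psi> (w + t *\<^sub>R G w)) has_real_derivative G w \<bullet> G w) (at 0)"
      by (rule has_real_derivative_along_line) (simp add: der[OF wb])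
    ultimately have "(f has_real_derivative \<epsilon>) (at 0)" unfolding f_def
      by (auto intro!: derivative_eq_intros)
    from DERIV_pos_inc_right[OF this \<epsilon>(1)]
    obtain d where d: "d > 0" "\<And>h. 0 < h \<Longrightarrow> h < d \<Longrightarrow> f 0 < f h" by auto
    define h where "h = min d (\<rho> - norm (w - x0)) / 2"
    have h: "0 < h" "h < d" "norm (w - x0) + h < \<rho>" using d(1) lt by (auto simp: h_def min_def field_simps)
    have n: "norm (w + h *\<^sub>R G w - x0) \<le> norm (w - x0) + h"
      using norm_triangle_ineq[of "w - x0" "h *\<^sub>R G w"] unit[OF wb] h by (simp add: algebra_simps)
    then have "(1 - \<epsilon>) * norm (w + h *\<^sub>R G w - x0) \<le> (1 - \<epsilon>) * (norm (w - x0) + h)"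
      using \<epsilon> by (intro mult_left_mono) auto
    then have "g (w + h *\<^sub>R G w) > g w"
      using d(2)[OF h(1,2)] by (simp add: g_def f_def algebra_simps)
    moreover have "w + h *\<^sub>R G w \<in> cball x0 \<rho>"
      using n h by (simp add: dist_norm norm_minus_commute)
    ultimately show False using max by fastforce
  qed
  then have "\<psi> w \<ge> \<psi> x0 + (1 - \<epsilon>) * \<rho>" using max[of x0] \<rho> by (simp add: g_def)
  then show ?thesis using w by blast
qed

text \<open>As \<epsilon> tends to 0, \<open>eikonal_growth\<close> shows that the maximum over the
  closed ball attains the Lipschitz bound, at a point \<open>y\<close> of the sphere. Then \<psi>
  has slope 1 all along the segment to \<open>y\<close>, and a gradient of norm 1 with inner product
  1 with the direction \<open>e\<close> equals \<open>e\<close>. At \<open>x0\<close> itself this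
  identifies \<open>e\<close> as \<open>G x0\<close>.\<close>

lemma eikonal_gradient_constant_pos:
  fixes \<psi> :: "plane \<Rightarrow> real"
  assumes der: "\<And>x. x \<in> ball x0 r \<Longrightarrow> (\<psi> has_derivative (\<lambda>h. G x \<bullet> h)) (at x)"
    and unit: "\<And>x. x \<in> ball x0 r \<Longrightarrow> norm (G x) = 1"
    and t: "0 \<le> t" "t < r"
  shows "G (x0 + t *\<^sub>R G x0) = G x0"
proof -
  obtain \<rho> where \<rho>: "t < \<rho>" "\<rho> < r" using t dense by blast
  then have \<rho>0: "\<rho> > 0" using t by simp
  have sub: "cball x0 \<rho> \<subseteq> ball x0 r" using \<rho> by auto
  have c: "continuous_on (cball x0 \<rho>) \<psi>"
    by (intro continuous_at_imp_continuous_on ballI has_derivative_continuous[OF der])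
      (use sub in blast)
  obtain y where y: "y \<in> cball x0 \<rho>" and max: "\<And>z. z \<in> cball x0 \<rho> \<Longrightarrow> \<psi> z \<le> \<psi> y"
    using continuous_attains_sup[of "cball x0 \<rho>" \<psi>] \<rho>0 c by auto
  have x0b: "x0 \<in> ball x0 r" using t by simp
  have lip: "\<psi> a - \<psi> b \<le> norm (a - b)" if "a \<in> ball x0 r" "b \<in> ball x0 r" for a b
    by (rule eikonal_lipschitz[OF der unit that])
  have ge: "\<psi> y \<ge> \<psi> x0 + \<rho>"
  proof (rule ccontr)
    assume "\<not> ?thesis"
    then have lt: "\<psi> y < \<psi> x0 + \<rho>" by simp
    \<comment> \<open>Chosen so that the loss \<open>\<epsilon> * \<rho>\<close> is at most half of
      the assumed defect; the bound 1/2 keeps \<epsilon> below 1.\<close>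
    define \<epsilon> where "\<epsilon> = min (1/2) ((\<psi> x0 + \<rho> - \<psi> y) / (2 * \<rho>))"
    have \<epsilon>: "0 < \<epsilon>" "\<epsilon> < 1" using lt \<rho>0 by (auto simp: \<epsilon>_def)
    have "\<epsilon> * \<rho> \<le> (\<psi> x0 + \<rho> - \<psi> y) / (2 * \<rho>) * \<rho>"
      by (intro mult_right_mono) (use \<rho>0 in \<open>auto simp: \<epsilon>_def\<close>)
    then have e: "\<epsilon> * \<rho> \<le> (\<psi> x0 + \<rho> - \<psi> y) / 2" using \<rho>0 by simp
    obtain w where "w \<in> cball x0 \<rho>" "\<psi> w \<ge> \<psi> x0 + (1 - \<epsilon>) * \<rho>"
      using eikonal_growth[OF der unit \<rho>0 \<rho>(2) \<epsilon>] by blast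
    then have "\<psi> y \<ge> \<psi> x0 + \<rho> - \<epsilon> * \<rho>" using max[of w] by (simp add: algebra_simps)
    then show False using e lt by (simp add: field_simps)
  qed
  have yb: "y \<in> ball x0 r" using y sub by blast
  have "norm (y - x0) \<le> \<rho>" using y by (simp add: dist_norm norm_minus_commute)
  with lip[OF yb x0b] ge have ny: "norm (y - x0) = \<rho>" and \<psi>y: "\<psi> y = \<psi> x0 + \<rho>" by auto
  define e where "e = (1 / \<rho>) *\<^sub>R (y - x0)"
  have ne: "norm e = 1" using ny \<rho>0 by (simp add: e_def)
  have ye: "y = x0 + \<rho> *\<^sub>R e" using \<rho>0 by (simp add: e_def)
  have inb: "x0 + u *\<^sub>R e \<in> ball x0 r" if "0 \<le> u" "u \<le> \<rho>" for u
    using that ne \<rho> by (simp add: dist_norm)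
  have lin: "\<psi> (x0 + u *\<^sub>R e) = \<psi> x0 + u" if u: "0 \<le> u" "u \<le> \<rho>" for u
  proof -
    have "\<psi> (x0 + u *\<^sub>R e) - \<psi> x0 \<le> u" using lip[OF inb[OF u] x0b] ne u by simp
    moreover have "y - (x0 + u *\<^sub>R e) = (\<rho> - u) *\<^sub>R e" by (simp add: ye algebra_simps)
    then have "\<psi> y - \<psi> (x0 + u *\<^sub>R e) \<le> \<rho> - u" using lip[OF yb inb[OF u]] ne u by simp
    ultimately show ?thesis using \<psi>y by simp
  qed
  have Ge: "G (x0 + u *\<^sub>R e) = e" if u: "0 \<le> u" "u < \<rho>" for u
  proof -
    define D where "D = G (x0 + u *\<^sub>R e) \<bullet> e - 1"
    define f where "f v = \<psi> (x0 + v *\<^sub>R e) - v" for v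
    have "(f has_real_derivative D) (at u)" unfolding f_def D_def
      by (intro DERIV_diff has_real_derivative_along_line der inb DERIV_ident) (use u in auto)
    moreover have "f v = \<psi> x0" if "0 \<le> v" "v \<le> \<rho>" for v using lin[OF that] by (simp add: f_def)
    then have eq: "f u = f (u + h)" if "0 < h" "h < \<rho> - u" for h using u that by simp
    \<comment> \<open>Only increments to the right are used, since for \<open>u = 0\<close> nothing
      is known about \<open>f\<close> on the left.\<close>
    have "D = 0"
    proof (rule ccontr)
      assume "D \<noteq> 0"
      then obtain d where d: "d > 0" "\<And>h. 0 < h \<Longrightarrow> h < d \<Longrightarrow> f u \<noteq> f (u + h)"
        using DERIV_pos_inc_right[OF calculation] DERIV_neg_dec_right[OF calculation]
        by (cases "D > 0") (use \<open>D \<noteq> 0\<close> in force)+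
      define h where "h = min d (\<rho> - u) / 2"
      have "0 < h" "h < d" "h < \<rho> - u" using d u by (auto simp: h_def min_def field_simps)
      then show False using d(2) eq by blast
    qed
    then have "G (x0 + u *\<^sub>R e) \<bullet> e = norm (G (x0 + u *\<^sub>R e)) * norm e"
      using unit[OF inb, of u] ne u by (simp add: D_def)
    then have "norm (G (x0 + u *\<^sub>R e)) *\<^sub>R e = norm e *\<^sub>R G (x0 + u *\<^sub>R e)"
      by (rule norm_cauchy_schwarz_eq[THEN iffD1])
    then show ?thesis using unit[OF inb, of u] ne u by simp
  qed
  have "G x0 = e" using Ge[of 0] \<rho>0 by simp
  then show ?thesis using Ge[of t] t \<rho> by simp
qed

lemma eikonal_gradient_constant:
  fixes \<psi> :: "plane \<Rightarrow> real"
  assumes der: "\<And>x. x \<in> ball x0 r \<Longrightarrow> (\<psi> has_derivative (\<lambda>h. G x \<bullet> h)) (at x)"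
    and unit: "\<And>x. x \<in> ball x0 r \<Longrightarrow> norm (G x) = 1"
    and t: "\<bar>t\<bar> < r"
  shows "G (x0 + t *\<^sub>R G x0) = G x0"
proof (cases "t \<ge> 0")
  case True
  then show ?thesis using eikonal_gradient_constant_pos[OF der unit] t by simp
next
  case False
  \<comment> \<open>The negative of \<psi> solves the same equation, and its gradient points
    backwards along the line.\<close>
  have "((\<lambda>x. - \<psi> x) has_derivative (\<lambda>h. - G x \<bullet> h)) (at x)" if "x \<in> ball x0 r" for x
    using has_derivative_minus[OF der[OF that]] by simp
  from eikonal_gradient_constant_pos[of x0 r "\<lambda>x. - \<psi> x" "\<lambda>x. - G x" "- t", OF this]
  show ?thesis using False t unit by simp
qed

text \<open>Constancy propagates along the chord because the set of parameters where the field has the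
  initial value is open and closed.\<close>

lemma field_constant_on_char_line:
  assumes U: "open U" "convex U" and cont: "continuous_on U s"
    and unit: "\<And>x. x \<in> U \<Longrightarrow> norm (s x) = 1"
    and pot: "\<And>x0. x0 \<in> U \<Longrightarrow> \<exists>r>0. \<exists>\<psi>. ball x0 r \<subseteq> U \<and>
        (\<forall>x\<in>ball x0 r. (\<psi> has_derivative (\<lambda>h. perp (s x) \<bullet> h)) (at x))"
    and x: "x \<in> U" and y: "y \<in> U" "y \<in> char_line s x"
  shows "s y = s x"
proof -
  obtain \<tau> where \<tau>: "y = x + \<tau> *\<^sub>R perp (s x)" using y(2) by (auto simp: char_line_def)
  define l where "l t = x + t *\<^sub>R perp (s x)" for t
  have perp_inj: "a = b" if "perp a = perp b" for a b
    using that by (simp add: plane_eq_iff)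
  \<comment> \<open>The gradient \<open>perp (s z)\<close> of the potential is also the direction of
    the characteristic line, so constancy along the gradient is constancy along that line.\<close>
  have local: "\<exists>r>0. \<forall>t. \<bar>t\<bar> < r \<longrightarrow> s (z + t *\<^sub>R perp (s z)) = s z" if z: "z \<in> U" for z
  proof -
    obtain r \<psi> where r: "r > 0" "ball z r \<subseteq> U"
      and d: "\<And>x. x \<in> ball z r \<Longrightarrow> (\<psi> has_derivative (\<lambda>h. perp (s x) \<bullet> h)) (at x)"
      using pot[OF z] by blast
    have "norm (perp (s x)) = 1" if "x \<in> ball z r" for x
      using that r unit by auto
    from perp_inj[OF eikonal_gradient_constant[OF d this]] show ?thesis using r(1) by blast
  qed
  define T where "T = l -` U"
  have cl: "continuous_on A l" for A unfolding l_def by (intro continuous_intros)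
  have oT: "open T" unfolding T_def using U(1) cl by (intro open_vimage)
  have "convex T" unfolding T_def l_def
  proof (rule convexI)
    fix a b u v :: real
    assume *: "a \<in> (\<lambda>t. x + t *\<^sub>R perp (s x)) -` U" "b \<in> (\<lambda>t. x + t *\<^sub>R perp (s x)) -` U"
      "0 \<le> u" "0 \<le> v" "u + v = 1"
    have "u *\<^sub>R x + v *\<^sub>R x = x" using *(5) by (metis scaleR_add_left scaleR_one)
    then have "x + (u *\<^sub>R a + v *\<^sub>R b) *\<^sub>R perp (s x)
        = u *\<^sub>R (x + a *\<^sub>R perp (s x)) + v *\<^sub>R (x + b *\<^sub>R perp (s x))"
      by (simp add: algebra_simps)
    then show "u *\<^sub>R a + v *\<^sub>R b \<in> (\<lambda>t. x + t *\<^sub>R perp (s x)) -` U"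
      using * convexD[OF U(2)] by simp
  qed
  then have conn: "connected T" by (rule convex_connected)
  define E where "E = {t \<in> T. s (l t) = s x}"
  have "continuous_on T (\<lambda>t. s (l t))"
    by (rule continuous_on_compose2[OF cont cl]) (auto simp: T_def)
  then have "closedin (top_of_set T) E"
    unfolding E_def by (rule continuous_closedin_preimage_constant)
  moreover have "openin (top_of_set T) E"
  proof -
    have "open E"
      unfolding open_dist
    proof
      fix t assume t: "t \<in> E"
      then obtain r where r: "r > 0" "\<And>h. \<bar>h\<bar> < r \<Longrightarrow> s (l t + h *\<^sub>R perp (s (l t))) = s (l t)"
        using local[of "l t"] by (auto simp: E_def T_def)
      obtain r' where r': "r' > 0" "\<And>u. dist u t < r' \<Longrightarrow> u \<in> T"
        using oT t unfolding open_dist E_def by auto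
      have "u \<in> E" if u: "dist u t < min r r'" for u
      proof -
        have "l u = l t + (u - t) *\<^sub>R perp (s (l t))" using t by (simp add: E_def l_def algebra_simps)
        then show ?thesis using r(2)[of "u - t"] r'(2)[of u] u t by (simp add: E_def dist_real_def)
      qed
      then show "\<exists>e>0. \<forall>u. dist u t < e \<longrightarrow> u \<in> E" using r r' by (intro exI[of _ "min r r'"]) auto
    qed
    then show ?thesis by (intro open_subset) (auto simp: E_def)
  qed
  ultimately have "E = {} \<or> E = T" using conn by (auto simp: connected_clopen)
  moreover have "0 \<in> E" using x by (simp add: E_def T_def l_def)
  moreover have "\<tau> \<in> T" using y(1) \<tau> by (simp add: T_def l_def)
  ultimately have "\<tau> \<in> E" by auto
  then show ?thesis by (simp add: E_def l_def \<tau>)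
qed

section \<open>Potentials of weakly divergence-free fields\<close>

lemma vector2_eq: "(vector [x, y] :: plane) = x *\<^sub>R axis 1 1 + y *\<^sub>R axis 2 1"
  by (simp add: plane_eq_iff axis_def)

lemma ex_2: "(\<exists>i::2. P i) \<longleftrightarrow> P 1 \<or> P 2"
  using forall_2[of "\<lambda>i. \<not> P i"] by blast

lemma continuous_on_swap_args:
  assumes "continuous_on (A \<times> B) (\<lambda>(x, y). Q x y)" "C \<subseteq> A"
  shows "continuous_on (B \<times> C) (\<lambda>(y, x). Q x y)"
proof -
  have "continuous_on (B \<times> C) (\<lambda>p. (snd p, fst p))" by (intro continuous_intros)
  from continuous_on_compose2[OF assms(1) this] assms(2) show ?thesis
    by (simp add: case_prod_unfold image_subset_iff mem_Times_iff subset_eq)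
qed

text \<open>The factors of product test functions. The derivative is an explicit argument so that it
  can be inserted into weak identities. The support stays strictly inside the interval, so products
  have compact support and boundary terms vanish.\<close>

definition bump :: "real \<Rightarrow> real \<Rightarrow> (real \<Rightarrow> real) \<Rightarrow> (real \<Rightarrow> real) \<Rightarrow> bool" where
  "bump a b f f' \<longleftrightarrow> (\<forall>x. (f has_real_derivative f' x) (at x)) \<and> continuous_on UNIV f' \<and>
     (\<exists>c d. a < c \<and> d < b \<and> (\<forall>x. x \<notin> {c..d} \<longrightarrow> f x = 0))"

lemma bumpD:
  assumes "bump a b f f'"
  shows "(f has_real_derivative f' x) (at x)" "continuous_on A f'" "continuous_on A f"
proof -
  show *: "(f has_real_derivative f' x) (at x)" for x using assms by (simp add: bump_def)
  show "continuous_on A f'" using assms continuous_on_subset unfolding bump_def by blast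
  show "continuous_on A f" using * by (intro DERIV_continuous_on) (auto intro: has_field_derivative_at_within)
qed

lemma bump_zeroE:
  assumes "bump a b f f'"
  obtains c d where "a < c" "d < b" "\<And>x. x \<notin> {c..d} \<Longrightarrow> f x = 0" "\<And>x. x \<notin> {c..d} \<Longrightarrow> f' x = 0"
proof -
  obtain c d where cd: "a < c" "d < b" "\<And>x. x \<notin> {c..d} \<Longrightarrow> f x = 0"
    using assms unfolding bump_def by blast
  have "f' x = 0" if x: "x \<notin> {c..d}" for x
  proof -
    have "eventually (\<lambda>y. y \<in> - {c..d}) (at x)"
      using x by (intro eventually_at_in_open') auto
    then have "eventually (\<lambda>y. y \<in> - {c..d}) (nhds x)"
      using x by (simp add: eventually_nhds_conv_at)
    then have "eventually (\<lambda>y. f y = 0) (nhds x)"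
      by eventually_elim (use cd in auto)
    from DERIV_cong_ev[OF refl this refl] have "((\<lambda>_. 0) has_real_derivative f' x) (at x)"
      using bumpD(1)[OF assms] by blast
    then show ?thesis using DERIV_unique DERIV_const by blast
  qed
  then show ?thesis using that cd by blast
qed

lemma has_real_derivative_pos_part_sq:
  "((\<lambda>x. (max 0 x)\<^sup>2 / 2) has_real_derivative max 0 x) (at (x::real))"
proof -
  consider "x > 0" | "x < 0" | "x = 0" by linarith
  then show ?thesis
  proof cases
    case 1
    have "((\<lambda>x. x\<^sup>2 / 2) has_real_derivative x) (at x)"
      by (auto intro!: derivative_eq_intros)
    moreover have "eventually (\<lambda>y. y\<^sup>2 / 2 = (max 0 y)\<^sup>2 / 2) (nhds x)"
      using eventually_nhds_in_open[of "{0<..}" x] 1 by (auto elim!: eventually_mono)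
    from DERIV_cong_ev[OF refl this refl] calculation show ?thesis using 1 by simp
  next
    case 2
    have "((\<lambda>x. 0) has_real_derivative 0) (at x)" by simp
    moreover have "eventually (\<lambda>y. 0 = (max 0 y)\<^sup>2 / 2) (nhds x)"
      using eventually_nhds_in_open[of "{..<0}" x] 2 by (auto elim!: eventually_mono)
    from DERIV_cong_ev[OF refl this refl] calculation show ?thesis using 2 by simp
  next
    case 3
    have "((\<lambda>h. (max 0 h)\<^sup>2 / 2 / h) \<longlongrightarrow> 0) (at (0::real))"
    proof (rule Lim_null_comparison)
      show "eventually (\<lambda>h. norm ((max 0 h)\<^sup>2 / 2 / h) \<le> \<bar>h\<bar>) (at (0::real))"
        by (auto simp: max_def power2_eq_square)
      show "((\<lambda>h. \<bar>h\<bar>) \<longlongrightarrow> 0) (at (0::real))"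
        by (intro tendsto_rabs_zero tendsto_ident_at)
    qed
    then show ?thesis using 3 by (simp add: DERIV_def)
  qed
qed

text \<open>The second difference of \<open>(max 0 x)\<^sup>2 / 2\<close> is a \<open>C\<^sup>1\<close> step whose derivative is a hat
  function.\<close>

definition hat :: "real \<Rightarrow> real \<Rightarrow> real" where
  "hat \<delta> x = max 0 (x + \<delta>) - 2 * max 0 x + max 0 (x - \<delta>)"

definition smooth_step :: "real \<Rightarrow> real \<Rightarrow> real" where
  "smooth_step \<delta> x = (max 0 (x + \<delta>))\<^sup>2 / 2 - 2 * ((max 0 x)\<^sup>2 / 2) + (max 0 (x - \<delta>))\<^sup>2 / 2"

lemma has_real_derivative_smooth_step:
  "((\<lambda>x. smooth_step \<delta> (x - c)) has_real_derivative hat \<delta> (x - c)) (at x)"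
proof -
  have *: "((\<lambda>x. (max 0 (x + k))\<^sup>2 / 2) has_real_derivative max 0 (x + k)) (at x)" for k :: real
    using DERIV_shift[of "\<lambda>x. (max 0 x)\<^sup>2 / 2" "max 0 (x + k)" x k]
      has_real_derivative_pos_part_sq by simp
  from DERIV_add[OF DERIV_diff[OF *[of "\<delta> - c"] DERIV_cmult[OF *[of "- c"], of 2]] *[of "- \<delta> - c"]]
  show ?thesis by (simp add: smooth_step_def hat_def algebra_simps)
qed

lemma hat_props:
  assumes "\<delta> > 0"
  shows "hat \<delta> x \<ge> 0" "hat \<delta> 0 = \<delta>" "\<bar>x\<bar> \<ge> \<delta> \<Longrightarrow> hat \<delta> x = 0"
    "x \<le> - \<delta> \<Longrightarrow> smooth_step \<delta> x = 0" "x \<ge> \<delta> \<Longrightarrow> smooth_step \<delta> x = \<delta>\<^sup>2"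
  using assms by (auto simp: hat_def smooth_step_def max_def power2_eq_square algebra_simps field_simps)

text \<open>If \<open>D\<close> were larger at \<open>x1\<close> than at \<open>x0\<close>, a value
  \<open>m\<close> in between and a plateau function, rising near \<open>x0\<close> where
  \<open>D\<close> is below \<open>m\<close> and falling near \<open>x1\<close> where
  \<open>D\<close> is above \<open>m\<close>, would give a nonzero integral. The reverse inequality
  follows from the same statement for \<open>- D\<close>.\<close>

lemma weakly_constant_aux:
  assumes D: "continuous_on {a..b} D"
    and weak: "\<And>f f'. bump a b f f' \<Longrightarrow> integral {a..b} (\<lambda>x. D x * f' x) = 0"
    and x: "a < x0" "x0 < x1" "x1 < b"
  shows "D x0 \<ge> (D x1 :: real)"
proof (rule ccontr)
  assume "\<not> ?thesis"
  then obtain m where m: "D x0 < m" "m < D x1" using dense by (meson not_le)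
  have "isCont D x0" "isCont D x1"
    using D x by (auto intro: continuous_on_interior)
  then have "eventually (\<lambda>y. D y < m) (nhds x0)" "eventually (\<lambda>y. m < D y) (nhds x1)"
    using m by (auto simp: isCont_def tendsto_at_iff_tendsto_nhds intro: order_tendstoD)
  then obtain d0 d1 where d: "d0 > 0" "\<And>y. \<bar>y - x0\<bar> < d0 \<Longrightarrow> D y < m"
    "d1 > 0" "\<And>y. \<bar>y - x1\<bar> < d1 \<Longrightarrow> m < D y"
    unfolding eventually_nhds_metric dist_real_def by blast
  obtain \<delta> where \<delta>: "\<delta> > 0" "\<delta> < d0" "\<delta> < d1" "\<delta> < x0 - a" "\<delta> < b - x1" "2 * \<delta> < x1 - x0"
  proof -
    have "min (min d0 d1) (min (min (x0 - a) (b - x1)) ((x1 - x0) / 2)) > 0" using x d by auto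
    then obtain \<delta> where "0 < \<delta>" "\<delta> < min (min d0 d1) (min (min (x0 - a) (b - x1)) ((x1 - x0) / 2))"
      using dense by blast
    then show ?thesis using that[of \<delta>] by simp
  qed
  \<comment> \<open>Two steps of equal height cancel to the right of \<open>x1\<close>, so
    \<open>f\<close> has compact support; its derivative is a positive hat at \<open>x0\<close> and
    a negative one at \<open>x1\<close>.\<close>
  define f where "f x = smooth_step \<delta> (x - x0) - smooth_step \<delta> (x - x1)" for x
  define f' where "f' x = hat \<delta> (x - x0) - hat \<delta> (x - x1)" for x
  note hp = hat_props[OF \<delta>(1)]
  have cf': "continuous_on A f'" for A unfolding f'_def hat_def by (intro continuous_intros)
  have bf: "bump a b f f'"
    unfolding bump_def
  proof (intro conjI allI exI)
    show "(f has_real_derivative f' x) (at x)" for x unfolding f_def f'_def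
      by (intro DERIV_diff has_real_derivative_smooth_step)
    show "a < x0 - \<delta>" "x1 + \<delta> < b" using \<delta> by auto
    show "x \<notin> {x0 - \<delta>..x1 + \<delta>} \<longrightarrow> f x = 0" for x
      using hp(4,5)[of "x - x0"] hp(4,5)[of "x - x1"] x \<delta> by (auto simp: f_def)
  qed (rule cf')
  have "(f' has_integral (f b - f a)) {a..b}"
    by (rule fundamental_theorem_of_calculus)
      (use x bumpD(1)[OF bf] in \<open>auto simp: has_real_derivative_iff_has_vector_derivative[symmetric]
        intro: has_field_derivative_at_within\<close>)
  moreover have "f a = 0" "f b = 0"
    using hp(4,5)[of "a - x0"] hp(4,5)[of "a - x1"] hp(4,5)[of "b - x0"] hp(4,5)[of "b - x1"] x \<delta>
    by (auto simp: f_def)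
  ultimately have "integral {a..b} f' = 0" by (simp add: integral_unique)
  \<comment> \<open>Since \<open>f'\<close> has integral zero, the constant \<open>m\<close> can be
    inserted, which makes the integrand nonnegative.\<close>
  then have "integral {a..b} (\<lambda>x. m * f' x - D x * f' x) = 0"
    using weak[OF bf] D cf'
    by (subst integral_diff) (auto intro!: integrable_continuous_interval continuous_intros)
  moreover have "m * f' y - D y * f' y \<ge> 0" for y
  proof -
    have "(m - D y) * hat \<delta> (y - x0) \<ge> 0"
    proof (cases "\<bar>y - x0\<bar> < \<delta>")
      case True then show ?thesis using d(2)[of y] \<delta> hp(1) by auto
    qed (simp add: hp(3))
    moreover have "(m - D y) * hat \<delta> (y - x1) \<le> 0"
    proof (cases "\<bar>y - x1\<bar> < \<delta>")
      case True then show ?thesis using d(4)[of y] \<delta> hp(1) by (auto simp: mult_le_0_iff)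
    qed (simp add: hp(3))
    ultimately show ?thesis by (simp add: f'_def algebra_simps)
  qed
  ultimately have "\<forall>x\<in>{a..b}. m * f' x - D x * f' x = 0"
    using integral_eq_0_iff[of a b "\<lambda>x. m * f' x - D x * f' x"] x
      continuous_on_diff[OF continuous_on_mult_left[OF cf'] continuous_on_mult[OF D cf']]
    by simp
  then have "(m - D x0) * f' x0 = 0" using x by (auto simp: algebra_simps)
  moreover have "f' x0 = \<delta>" using hp(2) hp(3)[of "x0 - x1"] \<delta> by (simp add: f'_def)
  ultimately show False using m \<delta> by simp
qed

text \<open>The weak form of \<open>A' = B\<close>. Subtracting a primitive \<open>W\<close> of
  \<open>B\<close> and integrating by parts reduces it to a weakly constant function
  \<open>D\<close>.\<close>

lemma du_Bois_Reymond:
  fixes A B :: "real \<Rightarrow> real"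
  assumes A: "continuous_on {a..b} A" and B: "continuous_on {a..b} B"
    and weak: "\<And>f f'. bump a b f f' \<Longrightarrow> integral {a..b} (\<lambda>x. A x * f' x + B x * f x) = 0"
    and x: "a < x0" "x0 \<le> x1" "x1 < b"
  shows "A x1 - A x0 = integral {x0..x1} B"
proof -
  define W where "W x = integral {a..x} B" for x
  define D where "D x = A x - W x" for x
  have ab: "a \<le> b" using x by simp
  have dW: "(W has_real_derivative B x) (at x within {a..b})" if "x \<in> {a..b}" for x
    unfolding W_def by (rule integral_has_real_derivative[OF B that])
  have cW: "continuous_on {a..b} W" using dW by (rule DERIV_continuous_on)
  have cD: "continuous_on {a..b} D" unfolding D_def by (intro continuous_intros A cW)
  have int: "integral {a..b} (\<lambda>x. D x * f' x) = 0" if f: "bump a b f f'" for f f'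
  proof -
    have "((\<lambda>x. B x * f x + W x * f' x) has_integral (W b * f b - W a * f a)) {a..b}"
    proof (rule fundamental_theorem_of_calculus[OF ab])
      fix x assume "x \<in> {a..b}"
      then show "((\<lambda>x. W x * f x) has_vector_derivative B x * f x + W x * f' x) (at x within {a..b})"
        unfolding has_real_derivative_iff_has_vector_derivative[symmetric]
        using DERIV_mult[OF dW has_field_derivative_at_within[OF bumpD(1)[OF f]]]
        by (simp add: algebra_simps)
    qed
    moreover obtain c d where "a < c" "d < b" "\<And>x. x \<notin> {c..d} \<Longrightarrow> f x = 0"
      using bump_zeroE[OF f] by metis
    then have "f a = 0" "f b = 0" by auto
    ultimately have 1: "integral {a..b} (\<lambda>x. B x * f x + W x * f' x) = 0"
      by (simp add: integral_unique)
    have "integral {a..b} (\<lambda>x. (A x * f' x + B x * f x) - (B x * f x + W x * f' x)) = 0"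
      using 1 weak[OF f] A B cW bumpD(2,3)[OF f]
      by (subst integral_diff) (auto intro!: integrable_continuous_interval continuous_intros)
    then show ?thesis by (simp add: D_def algebra_simps)
  qed
  have "D x0 = D x1"
  proof (cases "x0 = x1")
    case False
    then have lt: "x0 < x1" using x by simp
    have "D x0 \<ge> D x1" by (rule weakly_constant_aux[OF cD int x(1) lt x(3)])
    moreover have "- D x0 \<ge> - D x1"
      by (rule weakly_constant_aux[OF continuous_on_minus[OF cD] _ x(1) lt x(3)])
        (simp add: int)
    ultimately show ?thesis by simp
  qed simp
  moreover have "integral {a..x0} B + integral {x0..x1} B = integral {a..x1} B"
    by (rule Henstock_Kurzweil_Integration.integral_combine)
      (use x in \<open>auto intro!: integrable_continuous_interval continuous_on_subset[OF B]\<close>)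
  ultimately show ?thesis by (simp add: D_def W_def)
qed

text \<open>The one-dimensional lemma is applied to products of test functions, first in \<open>x\<close> and then
  in \<open>y\<close>.\<close>

lemma zero_flux:
  fixes P Q :: "real \<Rightarrow> real \<Rightarrow> real"
  assumes P: "continuous_on ({a..b} \<times> {c..d}) (\<lambda>(x, y). P x y)"
    and Q: "continuous_on ({a..b} \<times> {c..d}) (\<lambda>(x, y). Q x y)"
    and weak: "\<And>f f' g g'. bump a b f f' \<Longrightarrow> bump c d g g' \<Longrightarrow>
       integral {a..b} (\<lambda>x. integral {c..d} (\<lambda>y. P x y * (f' x * g y) + Q x y * (f x * g' y))) = 0"
    and x: "a < x0" "x0 \<le> x1" "x1 < b" and y: "c < y0" "y0 \<le> y1" "y1 < d"
  shows "integral {x0..x1} (\<lambda>x. Q x y1) - integral {x0..x1} (\<lambda>x. Q x y0)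
    = - integral {y0..y1} (\<lambda>y. P x1 y - P x0 y)"
proof -
  have cy: "continuous_on {c..d} (\<lambda>y. R x y)" if "continuous_on ({a..b} \<times> {c..d}) (\<lambda>(x, y). R x y)" "x \<in> {a..b}"
    for R :: "real \<Rightarrow> real \<Rightarrow> real" and x
    using continuous_on_compose2[OF that(1), of "{c..d}" "\<lambda>y. (x, y)"] that(2)
    by (simp add: continuous_on_Pair image_subset_iff)
  \<comment> \<open>With \<open>g\<close> fixed, the equation in \<open>x\<close> concerns the
    averages of \<open>P\<close> against \<open>g\<close> and of \<open>Q\<close> against
    \<open>g'\<close>. Its integrated form holds for every \<open>g\<close> and, after exchanging
    integrals, is again a weak equation, now in \<open>y\<close>.\<close>
  have step: "integral {c..d} (\<lambda>y. - integral {x0..x1} (\<lambda>x. Q x y) * g' y + (P x1 y - P x0 y) * g y) = 0"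
    if g: "bump c d g g'" for g g'
  proof -
    have "continuous_on ({a..b} \<times> {c..d}) (\<lambda>(x, y). P x y * g y)"
      "continuous_on ({a..b} \<times> {c..d}) (\<lambda>(x, y). Q x y * g' y)"
      using P Q continuous_on_compose2[OF bumpD(2)[OF g, of UNIV] continuous_on_snd[OF continuous_on_id], of "{a..b} \<times> {c..d}"]
        continuous_on_compose2[OF bumpD(3)[OF g, of UNIV] continuous_on_snd[OF continuous_on_id], of "{a..b} \<times> {c..d}"]
      by (auto simp: case_prod_unfold intro!: continuous_intros)
    note cc = this
    have cA: "continuous_on {a..b} (\<lambda>x. integral {c..d} (\<lambda>y. P x y * g y))"
      and cB: "continuous_on {a..b} (\<lambda>x. integral {c..d} (\<lambda>y. Q x y * g' y))"
      using integral_continuous_on_param[of "{a..b}" c d "\<lambda>x y. P x y * g y"]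
        integral_continuous_on_param[of "{a..b}" c d "\<lambda>x y. Q x y * g' y"] cc by simp_all
    have eq: "integral {c..d} (\<lambda>y. P x1 y * g y) - integral {c..d} (\<lambda>y. P x0 y * g y)
        = integral {x0..x1} (\<lambda>x. integral {c..d} (\<lambda>y. Q x y * g' y))"
    proof (rule du_Bois_Reymond[OF cA cB _ x])
      fix f f' assume f: "bump a b f f'"
      have "integral {a..b} (\<lambda>x. integral {c..d} (\<lambda>y. P x y * g y) * f' x + integral {c..d} (\<lambda>y. Q x y * g' y) * f x)
         = integral {a..b} (\<lambda>x. integral {c..d} (\<lambda>y. P x y * (f' x * g y) + Q x y * (f x * g' y)))"
      proof (rule integral_cong)
        fix x assume xab: "x \<in> {a..b}"
        have "(\<lambda>y. P x y * g y * f' x) integrable_on {c..d}" "(\<lambda>y. Q x y * g' y * f x) integrable_on {c..d}"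
          using cy[OF P xab] cy[OF Q xab] bumpD(2,3)[OF g]
          by (auto intro!: integrable_continuous_interval continuous_intros)
        from integral_add[OF this]
        show "integral {c..d} (\<lambda>y. P x y * g y) * f' x + integral {c..d} (\<lambda>y. Q x y * g' y) * f x
          = integral {c..d} (\<lambda>y. P x y * (f' x * g y) + Q x y * (f x * g' y))"
          by (simp add: algebra_simps)
      qed
      then show "integral {a..b} (\<lambda>x. integral {c..d} (\<lambda>y. P x y * g y) * f' x + integral {c..d} (\<lambda>y. Q x y * g' y) * f x) = 0"
        using weak[OF f g] by simp
    qed
    have "continuous_on (cbox (x0, c) (x1, d)) (\<lambda>(x, y). Q x y * g' y)"
      by (rule continuous_on_subset[OF cc(2)]) (use x in auto)
    from integral_swap_continuous[OF this]
    have sw: "integral {x0..x1} (\<lambda>x. integral {c..d} (\<lambda>y. Q x y * g' y))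
        = integral {c..d} (\<lambda>y. integral {x0..x1} (\<lambda>x. Q x y) * g' y)" by simp
    have "continuous_on ({c..d} \<times> cbox x0 x1) (\<lambda>(y, x). Q x y)"
      by (rule continuous_on_swap_args[OF Q]) (use x in auto)
    from integral_continuous_on_param[OF this]
    have "(\<lambda>y. integral {x0..x1} (\<lambda>x. Q x y) * g' y) integrable_on {c..d}"
      using bumpD(2)[OF g] by (auto intro!: integrable_continuous_interval continuous_intros)
    moreover have "(\<lambda>y. P x1 y * g y) integrable_on {c..d}" "(\<lambda>y. P x0 y * g y) integrable_on {c..d}"
      using cy[OF P] bumpD(3)[OF g] x
      by (auto intro!: integrable_continuous_interval continuous_intros)
    ultimately have "integral {c..d} (\<lambda>y. (P x1 y * g y - P x0 y * g y) - integral {x0..x1} (\<lambda>x. Q x y) * g' y) = 0"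
      using eq sw by (simp add: integral_diff integrable_diff)
    then show ?thesis by (simp add: algebra_simps)
  qed
  have "continuous_on ({c..d} \<times> cbox x0 x1) (\<lambda>(y, x). Q x y)"
    by (rule continuous_on_swap_args[OF Q]) (use x in auto)
  from integral_continuous_on_param[OF this]
  have "continuous_on {c..d} (\<lambda>y. - integral {x0..x1} (\<lambda>x. Q x y))"
    by (auto intro!: continuous_intros)
  moreover have "continuous_on {c..d} (\<lambda>y. P x1 y - P x0 y)"
    using cy[OF P] x by (intro continuous_intros) auto
  \<comment> \<open>The second application: in \<open>y\<close>, the derivative of minus the flux of
    \<open>Q\<close> is the jump of \<open>P\<close> between the vertical sides.\<close>
  ultimately have "- integral {x0..x1} (\<lambda>x. Q x y1) - - integral {x0..x1} (\<lambda>x. Q x y0)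
      = integral {y0..y1} (\<lambda>y. P x1 y - P x0 y)"
    by (rule du_Bois_Reymond[OF _ _ step y])
  then show ?thesis by simp
qed

section \<open>From the planar weak equation to a local potential\<close>

lemma integral_plane_iterated:
  fixes F :: "plane \<Rightarrow> real"
  assumes "continuous_on (cbox (vector [a, c]) (vector [b, d])) F"
  shows "integral (cbox (vector [a, c]) (vector [b, d])) F
    = integral {a..b} (\<lambda>x. integral {c..d} (\<lambda>y. F (vector [x, y])))"
proof -
  define g :: "real \<times> real \<Rightarrow> plane" where "g p = vector [fst p, snd p]" for p
  define h :: "plane \<Rightarrow> real \<times> real" where "h z = (z $ 1, z $ 2)" for z
  have gh: "g (h z) = z" and hg: "h (g p) = p" for z p
    by (simp_all add: g_def h_def plane_eq_iff)
  have g_cbox: "g ` cbox u v = cbox (g u) (g v)" for u v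
  proof (intro equalityI subsetI)
    fix z assume "z \<in> cbox (g u) (g v)"
    then have "h z \<in> cbox u v"
      by (cases u, cases v) (auto simp: mem_box_cart forall_2 g_def h_def)
    then show "z \<in> g ` cbox u v" using gh by (metis imageI)
  qed (cases u, cases v, auto simp: mem_box_cart forall_2 g_def)
  have h_cbox: "h ` cbox u v = cbox (h u) (h v)" for u v
    using g_cbox[of "h u" "h v"] by (simp add: gh) (metis (no_types) hg image_image image_ident image_cong)
  have cont_g: "continuous (at p) g" for p
    unfolding g_def vector2_eq by (intro continuous_intros)
  \<comment> \<open>The coordinate map sends boxes to boxes of equal content, so the change of
    variables has factor 1 and Fubini on pairs applies.\<close>
  have "((\<lambda>p. F (g p)) has_integral (1 / 1) *\<^sub>R integral (cbox (vector [a, c]) (vector [b, d])) F)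
      (h ` cbox (vector [a, c]) (vector [b, d]))"
  proof (rule has_integral_twiddle[OF _ hg gh cont_g])
    show "measure lborel (g ` cbox u v) = 1 * measure lborel (cbox u v)" for u v
    proof (cases u, cases v)
      fix u1 u2 v1 v2 assume uv: "u = (u1, u2)" "v = (v1, v2)"
      show ?thesis
        unfolding g_cbox content_cbox_if_cart uv content_Pair
        by (auto simp: g_def interval_eq_empty_cart ex_2 UNIV_2 content_real_if not_less)
    qed
    show "(F has_integral integral (cbox (vector [a, c]) (vector [b, d])) F) (cbox (vector [a, c]) (vector [b, d]))"
      using integrable_continuous[OF assms] by (rule integrable_integral)
    show "\<exists>w z. g ` cbox u v = cbox w z" for u v using g_cbox by blast
    show "\<exists>w z. h ` cbox u v = cbox w z" for u v using h_cbox by blast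
  qed simp
  moreover have hb: "h ` cbox (vector [a, c]) (vector [b, d]) = cbox (a, c) (b, d)"
    by (simp add: h_cbox) (simp add: h_def)
  ultimately have "integral (cbox (a, c) (b, d)) (\<lambda>p. F (g p)) = integral (cbox (vector [a, c]) (vector [b, d])) F"
    by (simp add: integral_unique)
  moreover have "continuous_on (cbox (a, c) (b, d)) (\<lambda>p. F (g p))"
  proof (rule continuous_on_compose2[OF assms])
    show "continuous_on (cbox (a, c) (b, d)) g"
      using cont_g by (simp add: continuous_at_imp_continuous_on)
    show "g ` cbox (a, c) (b, d) \<subseteq> cbox (vector [a, c]) (vector [b, d])"
      using g_cbox[of "(a, c)" "(b, d)"] by (simp add: g_def)
  qed
  ultimately show ?thesis using integral_prod_continuous[of a c b d "\<lambda>p. F (g p)"] by (simp add: g_def)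
qed

definition grad :: "(plane \<Rightarrow> real) \<Rightarrow> plane \<Rightarrow> plane" where
  "grad \<phi> x = (\<chi> i. pderiv_at i \<phi> x)"

definition weakly_div_free :: "plane set \<Rightarrow> (plane \<Rightarrow> plane) \<Rightarrow> bool" where
  "weakly_div_free U s \<longleftrightarrow> (\<forall>\<phi>. test_function U \<phi> \<longrightarrow> (LINT x:U|lebesgue. s x \<bullet> grad \<phi> x) = 0)"

lemma product_test_function:
  assumes f: "bump a b f f'" and g: "bump c d g g'"
    and sub: "cbox (vector [a, c]) (vector [b, d]) \<subseteq> U"
  shows "test_function U (\<lambda>z. f (z $ 1) * g (z $ 2))"
    and "grad (\<lambda>z. f (z $ 1) * g (z $ 2)) z = vector [f' (z $ 1) * g (z $ 2), f (z $ 1) * g' (z $ 2)]"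
proof -
  let ?\<phi> = "\<lambda>z::plane. f (z $ 1) * g (z $ 2)"
  have der: "(?\<phi> has_derivative (\<lambda>h. f (z $ 1) * (g' (z $ 2) * h $ 2) + f' (z $ 1) * h $ 1 * g (z $ 2))) (at z)" for z
  proof -
    have "((\<lambda>z. f (z $ 1)) has_derivative (\<lambda>h. f' (z $ 1) * h $ 1)) (at z)"
      by (rule has_derivative_compose[OF bounded_linear_imp_has_derivative[OF bounded_linear_vec_nth]
          bumpD(1)[OF f, unfolded has_field_derivative_def]])
    moreover have "((\<lambda>z. g (z $ 2)) has_derivative (\<lambda>h. g' (z $ 2) * h $ 2)) (at z)"
      by (rule has_derivative_compose[OF bounded_linear_imp_has_derivative[OF bounded_linear_vec_nth]
          bumpD(1)[OF g, unfolded has_field_derivative_def]])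
    ultimately show ?thesis by (rule has_derivative_mult)
  qed
  have pd: "pderiv_at 1 ?\<phi> = (\<lambda>z. f' (z $ 1) * g (z $ 2))" "pderiv_at 2 ?\<phi> = (\<lambda>z. f (z $ 1) * g' (z $ 2))"
    unfolding pderiv_at_def frechet_derivative_at[OF der, symmetric] by (auto simp: axis_def)
  show "grad ?\<phi> z = vector [f' (z $ 1) * g (z $ 2), f (z $ 1) * g' (z $ 2)]"
    by (simp add: plane_eq_iff grad_def pd)
  have c: "continuous_on UNIV (\<lambda>z::plane. k (z $ i))" if "continuous_on UNIV k" for k :: "real \<Rightarrow> real" and i
    by (rule continuous_on_compose2[OF that]) (auto intro!: continuous_intros)
  obtain a' b' where f0: "a < a'" "b' < b" "\<And>x. x \<notin> {a'..b'} \<Longrightarrow> f x = 0" using bump_zeroE[OF f] by metis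
  obtain c' d' where g0: "c < c'" "d' < d" "\<And>x. x \<notin> {c'..d'} \<Longrightarrow> g x = 0" using bump_zeroE[OF g] by metis
  have "?\<phi> z = 0" if "z \<notin> cbox (vector [a, c]) (vector [b, d])" for z
    using that f0(1,2) g0(1,2) f0(3)[of "z $ 1"] g0(3)[of "z $ 2"] by (auto simp: mem_box_cart forall_2)
  then have "\<exists>K. compact K \<and> K \<subseteq> U \<and> (\<forall>x. x \<notin> K \<longrightarrow> ?\<phi> x = 0)"
    using sub compact_cbox by blast
  moreover have "\<forall>i. continuous_on UNIV (pderiv_at i ?\<phi>)"
    unfolding forall_2 pd by (intro conjI continuous_intros c bumpD(2,3)[OF f] bumpD(2,3)[OF g])
  ultimately show "test_function U ?\<phi>"
    using der unfolding test_function_def differentiable_def by blast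
qed

text \<open>The product and its gradient vanish off the rectangle, so the integral over
  \<open>U\<close> reduces to one over a box, on which the integrand is continuous.\<close>

lemma weak_product_identity:
  assumes s: "continuous_on U s" "weakly_div_free U s"
    and sub: "cbox (vector [a, c]) (vector [b, d]) \<subseteq> U"
    and f: "bump a b f f'" and g: "bump c d g g'"
  shows "integral {a..b} (\<lambda>x. integral {c..d} (\<lambda>y.
      s (vector [x, y]) $ 1 * (f' x * g y) + s (vector [x, y]) $ 2 * (f x * g' y))) = 0"
proof -
  let ?\<phi> = "\<lambda>z::plane. f (z $ 1) * g (z $ 2)" and ?B = "cbox (vector [a, c]) (vector [b, d]) :: plane set"
  let ?F = "\<lambda>z. s z \<bullet> grad ?\<phi> z"
  note tf = product_test_function[OF f g sub]
  have F: "?F z = s z $ 1 * (f' (z $ 1) * g (z $ 2)) + s z $ 2 * (f (z $ 1) * g' (z $ 2))" for z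
    by (simp add: tf(2) inner_plane)
  have c: "continuous_on A (\<lambda>z::plane. k (z $ i))" if "continuous_on UNIV k" for A and k :: "real \<Rightarrow> real" and i
    by (rule continuous_on_compose2[OF that]) (auto intro!: continuous_intros)
  have cs: "continuous_on ?B s" using s(1) sub by (rule continuous_on_subset)
  have cF: "continuous_on ?B ?F" unfolding F
    by (intro continuous_intros c bumpD(2,3)[OF f] bumpD(2,3)[OF g] cs)
  obtain a' b' where f0: "a < a'" "b' < b" "\<And>x. x \<notin> {a'..b'} \<Longrightarrow> f x = 0" "\<And>x. x \<notin> {a'..b'} \<Longrightarrow> f' x = 0"
    using bump_zeroE[OF f] by metis
  obtain c' d' where g0: "c < c'" "d' < d" "\<And>x. x \<notin> {c'..d'} \<Longrightarrow> g x = 0" "\<And>x. x \<notin> {c'..d'} \<Longrightarrow> g' x = 0"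
    using bump_zeroE[OF g] by metis
  have F0: "?F z = 0" if "z \<notin> ?B" for z
    using that f0(1,2) g0(1,2) f0(3,4)[of "z $ 1"] g0(3,4)[of "z $ 2"] unfolding F
    by (auto simp: mem_box_cart forall_2)
  have "0 = (LINT z:U|lebesgue. ?F z)" using s(2) tf(1) by (simp add: weakly_div_free_def)
  also have "\<dots> = (LINT z:?B|lebesgue. ?F z)"
    unfolding set_lebesgue_integral_def
    by (intro Bochner_Integration.integral_cong refl) (use F0 sub in \<open>auto simp: indicator_def\<close>)
  also have "\<dots> = integral ?B ?F"
    by (rule set_lebesgue_integral_eq_integral(2)) (rule absolutely_integrable_continuous[OF cF])
  also have "\<dots> = integral {a..b} (\<lambda>x. integral {c..d} (\<lambda>y. ?F (vector [x, y])))"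
    by (rule integral_plane_iterated[OF cF])
  finally show ?thesis unfolding F by simp
qed

text \<open>\<psi> is the line integral of \<open>perp s\<close>, with components \<open>- Q\<close>
  and \<open>P\<close>, from a corner: up, then across. This form shows the \<open>x\<close>
  derivative; \<open>zero_flux\<close> permits the path across, then up, which shows the
  \<open>y\<close> derivative.\<close>

lemma local_potential:
  assumes U: "open U" and s: "continuous_on U s" "weakly_div_free U s" and x0: "x0 \<in> U"
  shows "\<exists>r>0. \<exists>\<psi>. ball x0 r \<subseteq> U \<and>
    (\<forall>x\<in>ball x0 r. (\<psi> has_derivative (\<lambda>h. perp (s x) \<bullet> h)) (at x))"
proof -
  obtain e where e: "e > 0" "ball x0 e \<subseteq> U" using U x0 open_contains_ball by blast
  \<comment> \<open>The box of half side \<open>2 * r\<close> has l1 radius \<open>4 * r\<close>,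
    which is less than \<open>e\<close>.\<close>
  define r where "r = e / 5"
  have r: "r > 0" using e by (simp add: r_def)
  define a b c d where abcd: "a = x0 $ 1 - 2 * r" "b = x0 $ 1 + 2 * r" "c = x0 $ 2 - 2 * r" "d = x0 $ 2 + 2 * r"
  have "cbox (vector [a, c]) (vector [b, d]) \<subseteq> ball x0 e"
  proof
    fix z :: plane assume "z \<in> cbox (vector [a, c]) (vector [b, d])"
    then have "\<bar>(z - x0) $ 1\<bar> + \<bar>(z - x0) $ 2\<bar> \<le> 4 * r"
      by (auto simp: mem_box_cart forall_2 abcd)
    moreover have "norm (z - x0) \<le> \<bar>(z - x0) $ 1\<bar> + \<bar>(z - x0) $ 2\<bar>"
      using norm_le_l1_cart[of "z - x0"] by (simp add: sum_2)
    ultimately have "norm (z - x0) < e" using r by (simp add: r_def)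
    then show "z \<in> ball x0 e" by (simp add: dist_norm norm_minus_commute)
  qed
  then have sub: "cbox (vector [a, c]) (vector [b, d]) \<subseteq> U" using e by blast
  define P where "P x y = s (vector [x, y]) $ 1" for x y
  define Q where "Q x y = s (vector [x, y]) $ 2" for x y
  have "continuous_on ({a..b} \<times> {c..d}) (\<lambda>p. vector [fst p, snd p] :: plane)"
    unfolding vector2_eq by (intro continuous_intros)
  from continuous_on_compose2[OF continuous_on_subset[OF s(1) sub] this]
  have "continuous_on ({a..b} \<times> {c..d}) (\<lambda>p. s (vector [fst p, snd p]))"
    by (simp add: image_subset_iff mem_Times_iff mem_box_cart forall_2)
  then have P: "continuous_on ({a..b} \<times> {c..d}) (\<lambda>(x, y). P x y)"
    and Q: "continuous_on ({a..b} \<times> {c..d}) (\<lambda>(x, y). Q x y)"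
    unfolding P_def Q_def case_prod_unfold by (auto intro!: continuous_intros)
  have Py: "continuous_on {c..d} (P x)" if "x \<in> {a..b}" for x
    using continuous_on_compose2[OF P, of "{c..d}" "\<lambda>y. (x, y)"] that
    by (simp add: continuous_on_Pair image_subset_iff)
  have Qx: "continuous_on {a..b} (\<lambda>x. Q x y)" if "y \<in> {c..d}" for y
    using continuous_on_compose2[OF Q, of "{a..b}" "\<lambda>x. (x, y)"] that
    by (simp add: continuous_on_Pair image_subset_iff)
  \<comment> \<open>The base corner is below and to the left of all points of
    \<open>X \<times> Y\<close>, so integrals run over genuine intervals, yet strictly inside the
    box, as \<open>zero_flux\<close> requires.\<close>
  define \<alpha> \<beta> where "\<alpha> = x0 $ 1 - r" "\<beta> = x0 $ 2 - r"
  define X Y where "X = {\<alpha><..<x0 $ 1 + r}" "Y = {\<beta><..<x0 $ 2 + r}"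
  have ab: "a < \<alpha>" "x0 $ 1 + r < b" "c < \<beta>" "x0 $ 2 + r < d" using r by (auto simp: abcd \<alpha>_\<beta>_def)
  define \<psi> where "\<psi> x y = integral {\<beta>..y} (P \<alpha>) - integral {\<alpha>..x} (\<lambda>t. Q t y)" for x y
  have \<psi>2: "\<psi> x y = integral {\<beta>..y} (P x) - integral {\<alpha>..x} (\<lambda>t. Q t \<beta>)" if "x \<in> X" "y \<in> Y" for x y
  proof -
    have "integral {\<alpha>..x} (\<lambda>x. Q x y) - integral {\<alpha>..x} (\<lambda>x. Q x \<beta>)
        = - integral {\<beta>..y} (\<lambda>y. P x y - P \<alpha> y)"
      by (rule zero_flux[OF P Q])
        (use weak_product_identity[OF s sub] that ab in \<open>auto simp: P_def Q_def X_Y_def\<close>)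
    moreover have "integral {\<beta>..y} (\<lambda>y. P x y - P \<alpha> y) = integral {\<beta>..y} (P x) - integral {\<beta>..y} (P \<alpha>)"
      using that ab
      by (intro integral_diff integrable_continuous_interval continuous_on_subset[OF Py])
        (auto simp: X_Y_def \<alpha>_\<beta>_def)
    ultimately show ?thesis by (simp add: \<psi>_def)
  qed
  have dx: "((\<lambda>x. \<psi> x y) has_real_derivative - Q x y) (at x)" if "x \<in> X" "y \<in> Y" for x y
  proof -
    have "((\<lambda>x. integral {\<alpha>..x} (\<lambda>t. Q t y)) has_real_derivative Q x y) (at x within {\<alpha>..b})"
      by (rule integral_has_real_derivative[OF continuous_on_subset[OF Qx]])
        (use that ab in \<open>auto simp: X_Y_def\<close>)
    moreover have "at x within {\<alpha>..b} = at x"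
      by (rule at_within_Icc_at) (use that ab in \<open>auto simp: X_Y_def\<close>)
    ultimately have "((\<lambda>x. integral {\<alpha>..x} (\<lambda>t. Q t y)) has_real_derivative Q x y) (at x)"
      by simp
    from DERIV_diff[OF DERIV_const this] show ?thesis by (simp add: \<psi>_def)
  qed
  have dy: "((\<lambda>y. \<psi> x y) has_real_derivative P x y) (at y)" if "x \<in> X" "y \<in> Y" for x y
  proof -
    have "((\<lambda>y. integral {\<beta>..y} (P x)) has_real_derivative P x y) (at y within {\<beta>..d})"
      by (rule integral_has_real_derivative[OF continuous_on_subset[OF Py]])
        (use that ab in \<open>auto simp: X_Y_def\<close>)
    moreover have "at y within {\<beta>..d} = at y"
      by (rule at_within_Icc_at) (use that ab in \<open>auto simp: X_Y_def\<close>)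
    ultimately have "((\<lambda>y. integral {\<beta>..y} (P x)) has_real_derivative P x y) (at y)"
      by simp
    from DERIV_diff[OF this DERIV_const]
    have d: "((\<lambda>y. integral {\<beta>..y} (P x) - integral {\<alpha>..x} (\<lambda>t. Q t \<beta>)) has_real_derivative P x y) (at y)"
      by simp
    have "open Y" by (simp add: X_Y_def)
    from has_field_derivative_transform_within_open[OF d this that(2)]
    show ?thesis using \<psi>2[OF that(1)] by simp
  qed
  have XY: "open (X \<times> Y)" by (auto simp: X_Y_def intro!: open_Times)
  have dXY: "((\<lambda>(x, y). \<psi> x y) has_derivative (\<lambda>(tx, ty). - Q x y * tx + P x y * ty)) (at (x, y))"
    if xy: "x \<in> X" "y \<in> Y" for x y
  proof -
    have "continuous_on (X \<times> Y) (\<lambda>(x, y). P x y)"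
      by (rule continuous_on_subset[OF P]) (use ab in \<open>auto simp: X_Y_def\<close>)
    then have "continuous_on (X \<times> Y) (\<lambda>(x, y). blinfun_mult_right (P x y))"
      unfolding case_prod_unfold by (rule bounded_linear.continuous_on[OF bounded_linear_blinfun_mult_right])
    \<comment> \<open>Differentiability needs continuity of one partial derivative and mere
      existence of the other.\<close>
    then have cb: "continuous (at (x, y) within X \<times> Y) (\<lambda>(x, y). blinfun_mult_right (P x y))"
      using xy by (auto simp: continuous_on_eq_continuous_within)
    have "((\<lambda>(x, y). \<psi> x y) has_derivative (\<lambda>(tx, ty). - Q x y * tx + blinfun_mult_right (P x y) ty))
        (at (x, y) within X \<times> Y)"
    proof (rule has_derivative_partialsI[OF _ _ cb xy(2)])
      show "((\<lambda>x. \<psi> x y) has_derivative (*) (- Q x y)) (at x within X)"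
        using dx[OF xy] by (simp add: has_field_derivative_def has_derivative_at_withinI)
      show "((\<lambda>y. \<psi> u y) has_derivative blinfun_apply (blinfun_mult_right (P u v))) (at v within Y)"
        if "u \<in> X" "v \<in> Y" for u v
        using dy[OF that] by (simp add: has_field_derivative_def has_derivative_at_withinI)
    qed (simp add: X_Y_def)
    moreover have "at (x, y) within X \<times> Y = at (x, y)"
      by (rule at_within_open[OF _ XY]) (use xy in simp)
    ultimately show ?thesis by simp
  qed
  have "((\<lambda>z. \<psi> (z $ 1) (z $ 2)) has_derivative (\<lambda>h. perp (s z) \<bullet> h)) (at z)" if z: "z \<in> ball x0 r" for z
  proof -
    have "\<bar>(z - x0) $ i\<bar> < r" for i
      using component_le_norm_cart[of "z - x0" i] z by (simp add: dist_norm norm_minus_commute)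
    from this[of 1] this[of 2] have "z $ 1 \<in> X" "z $ 2 \<in> Y" by (auto simp: X_Y_def \<alpha>_\<beta>_def)
    note d = dXY[OF this]
    have "((\<lambda>z. (z $ 1, z $ 2)) has_derivative (\<lambda>h. (h $ 1, h $ 2))) (at z)"
      by (intro has_derivative_Pair bounded_linear_imp_has_derivative bounded_linear_vec_nth)
    from has_derivative_compose[OF this d]
    have "((\<lambda>z. \<psi> (z $ 1) (z $ 2)) has_derivative (\<lambda>h. - Q (z $ 1) (z $ 2) * h $ 1 + P (z $ 1) (z $ 2) * h $ 2)) (at z)"
      by simp
    moreover have "vector [z $ 1, z $ 2] = z" by (simp add: plane_eq_iff)
    ultimately show ?thesis by (simp add: P_def Q_def inner_plane)
  qed
  moreover have "ball x0 r \<subseteq> U" using e r by (auto simp: r_def)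
  ultimately show ?thesis using r by (intro exI[of _ r] conjI exI[of _ "\<lambda>z. \<psi> (z $ 1) (z $ 2)"]) auto
qed

section \<open>Sums of measures and integration by parts\<close>

text \<open>Perturbing a signed measure by a density means adding the positive and the negative part
  of the density to the two measures of a decomposition.\<close>

definition add_measure :: "'a measure \<Rightarrow> 'a measure \<Rightarrow> 'a measure" where
  "add_measure M N = measure_of (space M) (sets M) (\<lambda>A. emeasure M A + emeasure N A)"

context
  fixes M N :: "'a measure" assumes sets_eq: "sets N = sets M"
begin

lemma sets_add_measure [simp]: "sets (add_measure M N) = sets M"
  and space_add_measure [simp]: "space (add_measure M N) = space M"
  by (simp_all add: add_measure_def)

lemma emeasure_add_measure:
  assumes "A \<in> sets M"
  shows "emeasure (add_measure M N) A = emeasure M A + emeasure N A"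
  unfolding add_measure_def
proof (rule emeasure_measure_of_sigma)
  show "countably_additive (sets M) (\<lambda>A. emeasure M A + emeasure N A)"
  proof (rule countably_additiveI)
    fix A :: "nat \<Rightarrow> 'a set" assume A: "range A \<subseteq> sets M" "disjoint_family A"
    have "(\<Sum>i. emeasure M (A i) + emeasure N (A i)) = (\<Sum>i. emeasure M (A i)) + (\<Sum>i. emeasure N (A i))"
      by (intro suminf_add[symmetric] summableI)
    then show "(\<Sum>i. emeasure M (A i) + emeasure N (A i)) = emeasure M (\<Union> (range A)) + emeasure N (\<Union> (range A))"
      using A sets_eq by (simp add: suminf_emeasure)
  qed
qed (auto simp: positive_def assms sets.sigma_algebra_axioms)

lemma nn_integral_add_measure:
  assumes "f \<in> borel_measurable M"
  shows "nn_integral (add_measure M N) f = nn_integral M f + nn_integral N f"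
proof -
  have m: "g \<in> borel_measurable (add_measure M N) \<longleftrightarrow> g \<in> borel_measurable M"
    "g \<in> borel_measurable N \<longleftrightarrow> g \<in> borel_measurable M" for g :: "'a \<Rightarrow> ennreal"
    using measurable_cong_sets[of "add_measure M N" M borel borel]
      measurable_cong_sets[of N M borel borel] sets_eq by auto
  show ?thesis
    using assms
  proof (induct rule: borel_measurable_induct)
    case (cong f g)
    have "nn_integral M f = nn_integral M g" "nn_integral N f = nn_integral N g"
      "nn_integral (add_measure M N) f = nn_integral (add_measure M N) g"
      using cong(3) sets_eq_imp_space_eq[OF sets_eq] by (auto intro!: nn_integral_cong)
    then show ?case using cong by simp
  next
    case (set A)
    then show ?case by (simp add: emeasure_add_measure sets_eq)
  next
    case (mult u c)
    then show ?case by (simp add: nn_integral_cmult m distrib_left)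
  next
    case (add u v)
    then show ?case by (simp add: nn_integral_add m algebra_simps)
  next
    case (seq U)
    have "nn_integral K (SUP i. U i) = (SUP i. nn_integral K (U i))"
      if "\<And>i. U i \<in> borel_measurable K" for K :: "'a measure"
      using nn_integral_monotone_convergence_SUP[OF \<open>incseq U\<close> that] by (simp add: SUP_apply[abs_def])
    moreover have "(SUP i. nn_integral M (U i) + nn_integral N (U i))
        = (SUP i. nn_integral M (U i)) + (SUP i. nn_integral N (U i))"
      using \<open>incseq U\<close> by (intro ennreal_SUP_add) (auto simp: incseq_def le_fun_def intro!: nn_integral_mono)
    ultimately show ?case using seq(1,3) by (simp add: m del: Sup_apply SUP_apply)
  qed
qed

lemma integral_add_measure:
  fixes f :: "'a \<Rightarrow> real"
  assumes M: "integrable M f" and N: "integrable N f"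
  shows "integrable (add_measure M N) f"
    and "integral\<^sup>L (add_measure M N) f = integral\<^sup>L M f + integral\<^sup>L N f"
proof -
  have fM: "f \<in> borel_measurable M" using M by auto
  have fA: "f \<in> borel_measurable (add_measure M N)"
    using fM measurable_cong_sets[of "add_measure M N" M borel borel] by auto
  have n: "nn_integral (add_measure M N) (\<lambda>x. ennreal (g x)) = nn_integral M (\<lambda>x. ennreal (g x)) + nn_integral N (\<lambda>x. ennreal (g x))"
    if "g \<in> borel_measurable M" for g :: "'a \<Rightarrow> real"
    using that by (intro nn_integral_add_measure) auto
  show i: "integrable (add_measure M N) f"
    using M N fA fM by (simp add: integrable_iff_bounded n)
  have "(\<integral>\<^sup>+x. ennreal (f x) \<partial>M) < top" "(\<integral>\<^sup>+x. ennreal (f x) \<partial>N) < top"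
    "(\<integral>\<^sup>+x. ennreal (- f x) \<partial>M) < top" "(\<integral>\<^sup>+x. ennreal (- f x) \<partial>N) < top"
    using M N by (auto simp: real_integrable_def top.not_eq_extremum)
  then show "integral\<^sup>L (add_measure M N) f = integral\<^sup>L M f + integral\<^sup>L N f"
    using M N i fM by (simp add: real_lebesgue_integral_def n enn2real_plus)
qed

lemma finite_add_measure:
  assumes "finite_measure M" "finite_measure N"
  shows "finite_measure (add_measure M N)"
    and "A \<in> sets M \<Longrightarrow> measure (add_measure M N) A = measure M A + measure N A"
proof -
  have "emeasure M (space M) \<noteq> \<infinity>" "emeasure N (space N) \<noteq> \<infinity>"
    using assms by (simp_all add: finite_measure.emeasure_finite)
  then show "finite_measure (add_measure M N)"
    using sets_eq_imp_space_eq[OF sets_eq]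
    by (intro finite_measureI) (simp add: emeasure_add_measure ennreal_add_eq_top)
  show "measure (add_measure M N) A = measure M A + measure N A" if "A \<in> sets M"
    using finite_measure.emeasure_finite[OF assms(1), of A] finite_measure.emeasure_finite[OF assms(2), of A]
    unfolding measure_def emeasure_add_measure[OF that]
    by (simp add: enn2real_plus top.not_eq_extremum)
qed

end

text \<open>Stated for the positive part only: applied to \<open>h\<close> and to \<open>- h\<close>
  it yields both parts of the signed measure with density \<open>h\<close>.\<close>

lemma density_pos_part:
  fixes h f :: "plane \<Rightarrow> real"
  assumes h: "integrable lborel h" and f: "f \<in> borel_measurable borel" and hf: "integrable lborel (\<lambda>x. h x * f x)"
  defines "\<mu> \<equiv> density lborel (\<lambda>x. ennreal (max 0 (h x)))"
  shows "finite_measure \<mu>" "sets \<mu> = sets borel"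
    and "B \<in> sets borel \<Longrightarrow> measure \<mu> B = (LINT x:B|lborel. max 0 (h x))"
    and "integrable \<mu> f" "integral\<^sup>L \<mu> f = (LINT x|lborel. max 0 (h x) * f x)"
    and "integrable lborel (\<lambda>x. max 0 (h x) * f x)"
proof -
  have hb [measurable]: "h \<in> borel_measurable borel" using h by simp
  have m: "integrable lborel (\<lambda>x. max 0 (h x))" using h by (intro integrable_max) auto
  have e: "emeasure \<mu> B = ennreal (LINT x:B|lborel. max 0 (h x))" if B: "B \<in> sets borel" for B
  proof -
    have "emeasure \<mu> B = (\<integral>\<^sup>+x. ennreal (indicator B x *\<^sub>R max 0 (h x)) \<partial>lborel)"
      unfolding \<mu>_def using B by (subst emeasure_density) (auto intro!: nn_integral_cong simp: indicator_def)
    also have "\<dots> = ennreal (LINT x:B|lborel. max 0 (h x))"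
      unfolding set_lebesgue_integral_def
      by (rule nn_integral_eq_integral[OF integrable_mult_indicator[OF _ m]]) (use B in auto)
    finally show ?thesis .
  qed
  have nn: "0 \<le> (LINT x:B|lborel. max 0 (h x))" for B
    unfolding set_lebesgue_integral_def by (rule integral_nonneg_AE) auto
  show "sets \<mu> = sets borel" by (simp add: \<mu>_def)
  show "finite_measure \<mu>"
  proof (rule finite_measureI)
    have "space \<mu> = UNIV" by (simp add: \<mu>_def)
    then show "emeasure \<mu> (space \<mu>) \<noteq> \<infinity>" using e[of UNIV] by simp
  qed
  show "measure \<mu> B = (LINT x:B|lborel. max 0 (h x))" if "B \<in> sets borel"
    using nn e[OF that] by (simp add: measure_def)
  show i: "integrable lborel (\<lambda>x. max 0 (h x) * f x)"
    by (rule Bochner_Integration.integrable_bound[OF hf])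
      (use f in \<open>auto simp: abs_mult intro!: mult_right_mono\<close>)
  show "integrable \<mu> f" unfolding \<mu>_def by (subst integrable_density) (use f i in auto)
  show "integral\<^sup>L \<mu> f = (LINT x|lborel. max 0 (h x) * f x)"
    unfolding \<mu>_def by (subst integral_density) (use f in auto)
qed

lemma has_signed_integral_add_density:
  fixes h f :: "plane \<Rightarrow> real"
  assumes m: "has_signed_integral m f c" and h: "integrable lborel h"
    and f: "f \<in> borel_measurable borel" and hf: "integrable lborel (\<lambda>x. h x * f x)"
    and m': "\<And>B. B \<in> sets borel \<Longrightarrow> m' B = m B + (LINT x:B|lborel. h x)"
  shows "has_signed_integral m' f (c + (LINT x|lborel. h x * f x))"
proof -
  obtain \<mu> \<nu> where fin: "finite_measure \<mu>" "finite_measure \<nu>"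
    and sets: "sets \<mu> = sets borel" "sets \<nu> = sets borel"
    and mB: "\<And>B. B \<in> sets borel \<Longrightarrow> m B = measure \<mu> B - measure \<nu> B"
    and int: "integrable \<mu> f" "integrable \<nu> f"
    and c: "c = (LINT x|\<mu>. f x) - (LINT x|\<nu>. f x)"
    using m unfolding has_signed_integral_def by blast
  have h': "integrable lborel (\<lambda>x. - h x)" "integrable lborel (\<lambda>x. - h x * f x)" using h hf by auto
  note p = density_pos_part[OF h f hf] and n = density_pos_part[OF h'(1) f h'(2)]
  let ?p = "density lborel (\<lambda>x. ennreal (max 0 (h x)))" and ?n = "density lborel (\<lambda>x. ennreal (max 0 (- h x)))"
  have sp: "sets ?p = sets \<mu>" and sn: "sets ?n = sets \<nu>" using sets by simp_all
  have sint: "set_integrable lborel B g" if "integrable lborel g" "B \<in> sets borel" for B and g :: "plane \<Rightarrow> real"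
    using that unfolding set_integrable_def by (intro integrable_mult_indicator) auto
  have hm: "integrable lborel (\<lambda>x. max 0 (h x))" "integrable lborel (\<lambda>x. max 0 (- h x))"
    using h by (auto intro!: integrable_max)
  have "m' B = measure (add_measure \<mu> ?p) B - measure (add_measure \<nu> ?n) B" if B: "B \<in> sets borel" for B
  proof -
    have "(LINT x:B|lborel. h x) = (LINT x:B|lborel. max 0 (h x) - max 0 (- h x))"
      by (rule arg_cong[where f = "set_lebesgue_integral lborel B"]) (auto simp: max_def)
    also have "\<dots> = (LINT x:B|lborel. max 0 (h x)) - (LINT x:B|lborel. max 0 (- h x))"
      using sint[OF hm(1) B] sint[OF hm(2) B] by (rule set_integral_diff(2))
    finally show ?thesis
      using m'[OF B] mB[OF B] B sets p(3)[OF B] n(3)[OF B]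
      by (simp add: finite_add_measure(2)[OF sp fin(1) p(1)] finite_add_measure(2)[OF sn fin(2) n(1)])
  qed
  moreover have "(LINT x|lborel. h x * f x) = (LINT x|lborel. max 0 (h x) * f x - max 0 (- h x) * f x)"
    by (intro Bochner_Integration.integral_cong) (auto simp: max_def)
  then have "(LINT x|lborel. h x * f x) = (LINT x|?p. f x) - (LINT x|?n. f x)"
    using p(5,6) n(5,6) by simp
  then have "c + (LINT x|lborel. h x * f x) = (LINT x|add_measure \<mu> ?p. f x) - (LINT x|add_measure \<nu> ?n. f x)"
    using c by (simp add: integral_add_measure(2)[OF sp int(1) p(4)] integral_add_measure(2)[OF sn int(2) n(4)])
  ultimately show ?thesis
    unfolding has_signed_integral_def
    using finite_add_measure(1)[OF sp fin(1) p(1)] finite_add_measure(1)[OF sn fin(2) n(1)]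
      integral_add_measure(1)[OF sp int(1) p(4)] integral_add_measure(1)[OF sn int(2) n(4)]
      sets sets_add_measure[OF sp] sets_add_measure[OF sn]
    by (intro exI[of _ "add_measure \<mu> ?p"] exI[of _ "add_measure \<nu> ?n"]) auto
qed

section \<open>Planar test functions and integration by parts\<close>

lemma continuous_compact_support_integrable:
  fixes f :: "plane \<Rightarrow> 'b::{banach, second_countable_topology}"
  assumes "continuous_on UNIV f" "compact K" "\<And>x. x \<notin> K \<Longrightarrow> f x = 0"
  shows "integrable lborel f" "integrable lebesgue f" "f \<in> borel_measurable borel"
proof -
  have "integrable lborel (\<lambda>x. indicator K x *\<^sub>R f x)"
    using assms by (intro borel_integrable_compact) (auto intro: continuous_on_subset)
  moreover have "(\<lambda>x. indicator K x *\<^sub>R f x) = f" using assms(3) by (auto simp: indicator_def)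
  ultimately show i: "integrable lborel f" by simp
  show m: "f \<in> borel_measurable borel" using assms(1) by (rule borel_measurable_continuous_onI)
  show "integrable lebesgue f" using i m by (simp add: integrable_completion)
qed

lemma pderiv_at_eq:
  assumes "(\<phi> has_derivative D) (at x)"
  shows "pderiv_at i \<phi> x = D (axis i 1)"
  using frechet_derivative_at[OF assms] by (simp add: pderiv_at_def)

lemma pderiv_at_zero_outside:
  assumes K: "compact K" "\<And>x. x \<notin> K \<Longrightarrow> \<phi> x = 0" and x: "x \<notin> K"
  shows "pderiv_at i \<phi> x = 0"
proof -
  have "(\<phi> has_derivative (\<lambda>_. 0)) (at x)"
    by (rule has_derivative_transform_within_open[of "\<lambda>_. 0" _ _ _ "- K"])
      (use K x compact_imp_closed in auto)
  then show ?thesis by (simp add: pderiv_at_eq)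
qed

lemma test_functionE:
  assumes "test_function \<Omega> \<phi>"
  obtains K where "compact K" "K \<subseteq> \<Omega>" "\<And>x. x \<notin> K \<Longrightarrow> \<phi> x = 0" "\<And>x i. x \<notin> K \<Longrightarrow> pderiv_at i \<phi> x = 0"
    "continuous_on UNIV \<phi>" "\<And>i. continuous_on UNIV (pderiv_at i \<phi>)" "\<And>x. \<phi> differentiable (at x)"
proof -
  obtain K where K: "compact K" "K \<subseteq> \<Omega>" "\<And>x. x \<notin> K \<Longrightarrow> \<phi> x = 0"
    using assms unfolding test_function_def by blast
  have d: "\<phi> differentiable (at x)" for x using assms by (simp add: test_function_def)
  then have "continuous_on UNIV \<phi>"
    by (simp add: differentiable_imp_continuous_within continuous_at_imp_continuous_on)
  moreover have "pderiv_at i \<phi> x = 0" if "x \<notin> K" for x i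
    using pderiv_at_zero_outside[OF K(1) _ that] K(3) by blast
  moreover have "continuous_on UNIV (pderiv_at i \<phi>)" for i
    using assms by (simp add: test_function_def)
  ultimately show ?thesis using that K d by blast
qed

text \<open>The integral of a difference quotient vanishes by translation invariance.\<close>

lemma integral_pderiv_at_zero:
  fixes h :: "plane \<Rightarrow> real"
  assumes d: "\<And>x. h differentiable (at x)" and cont: "continuous_on UNIV (pderiv_at i h)"
    and K: "compact K" "\<And>x. x \<notin> K \<Longrightarrow> h x = 0"
  shows "(LINT x|lborel. pderiv_at i h x) = 0"
proof -
  let ?e = "axis i 1 :: plane"
  have ch: "continuous_on UNIV h"
    using d by (simp add: differentiable_imp_continuous_within continuous_at_imp_continuous_on)
  have ih: "integrable lborel h" "h \<in> borel_measurable borel"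
    using K(2) by (auto intro!: continuous_compact_support_integrable[OF ch K(1)])
  have p0: "pderiv_at i h x = 0" if "x \<notin> K" for x
    using pderiv_at_zero_outside[OF K(1) _ that] K(2) by blast
  have ip: "pderiv_at i h \<in> borel_measurable borel"
    using cont by (rule borel_measurable_continuous_onI)
  have dl: "((\<lambda>t. h (x + t *\<^sub>R ?e)) has_real_derivative pderiv_at i h (x + t *\<^sub>R ?e)) (at t)" for x t
  proof -
    have D: "(h has_derivative frechet_derivative h (at (x + t *\<^sub>R ?e))) (at (x + t *\<^sub>R ?e))"
      using d frechet_derivative_works by blast
    have "((\<lambda>t. x + t *\<^sub>R ?e) has_derivative (\<lambda>s. s *\<^sub>R ?e)) (at t)"
      by (auto intro!: derivative_eq_intros)
    from has_derivative_compose[OF this D]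
    have "((\<lambda>t. h (x + t *\<^sub>R ?e)) has_derivative (\<lambda>s. frechet_derivative h (at (x + t *\<^sub>R ?e)) (s *\<^sub>R ?e))) (at t)" .
    then show ?thesis
      using linear_frechet_derivative[OF d, of "x + t *\<^sub>R ?e"]
      by (simp add: has_field_derivative_def pderiv_at_def linear_cmul mult_commute_abs)
  qed
  have "bounded (pderiv_at i h ` K)"
    using compact_continuous_image[OF continuous_on_subset[OF cont] K(1)] compact_imp_bounded by blast
  then obtain M0 where M0: "\<And>x. x \<in> K \<Longrightarrow> \<bar>pderiv_at i h x\<bar> \<le> M0" by (auto simp: bounded_iff)
  define M where "M = max M0 0"
  have M: "\<bar>pderiv_at i h x\<bar> \<le> M" for x
    using M0[of x] p0[of x] by (cases "x \<in> K") (auto simp: M_def)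
  obtain R where R: "\<And>x. x \<in> K \<Longrightarrow> norm x \<le> R" using compact_imp_bounded[OF K(1)] by (auto simp: bounded_iff)
  define q where "q n x = (h (x + (1 / real (Suc n)) *\<^sub>R ?e) - h x) / (1 / real (Suc n))" for n x
  have "(\<lambda>n. LINT x|lborel. q n x) \<longlonglongrightarrow> (LINT x|lborel. pderiv_at i h x)"
  proof (rule integral_dominated_convergence)
    \<comment> \<open>The increments have length at most 1 and \<open>K\<close> has radius at most
      \<open>R\<close>, so all quotients vanish beyond \<open>R + 1\<close>; elsewhere the mean
      value theorem bounds them by \<open>M\<close>.\<close>
    show "integrable lborel (\<lambda>x. M * indicator (cball 0 (R + 1)) x)"
      by (intro integrable_mult_right integrable_real_indicator) (auto simp: emeasure_bounded_finite[OF bounded_cball, unfolded infinity_ennreal_def])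
    show "pderiv_at i h \<in> borel_measurable lborel" using ip by simp
    have "(\<lambda>x. h (x + c)) \<in> borel_measurable borel" for c
      by (intro borel_measurable_continuous_onI continuous_on_compose2[OF ch] continuous_intros) auto
    then show "q n \<in> borel_measurable lborel" for n using ih(2) unfolding q_def by simp
    show "AE x in lborel. (\<lambda>n. q n x) \<longlonglongrightarrow> pderiv_at i h x"
    proof (rule AE_I2)
      fix x
      have "((\<lambda>t. (h (x + t *\<^sub>R ?e) - h x) / t) \<longlongrightarrow> pderiv_at i h x) (at 0)"
        using dl[of x 0] by (simp add: DERIV_def)
      moreover have "filterlim (\<lambda>n. 1 / real (Suc n)) (at 0) sequentially"
        unfolding filterlim_at
        using LIMSEQ_inverse_real_of_nat by (auto simp: inverse_eq_divide)
      ultimately show "(\<lambda>n. q n x) \<longlonglongrightarrow> pderiv_at i h x"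
        unfolding q_def by (rule filterlim_compose)
    qed
    show "AE x in lborel. norm (q n x) \<le> M * indicator (cball 0 (R + 1)) x" for n
    proof (rule AE_I2)
      fix x
      define \<tau> where "\<tau> = 1 / real (Suc n)"
      have \<tau>: "0 < \<tau>" "\<tau> \<le> 1" by (auto simp: \<tau>_def)
      obtain z where z: "h (x + \<tau> *\<^sub>R ?e) - h (x + 0 *\<^sub>R ?e) = (\<tau> - 0) * pderiv_at i h (x + z *\<^sub>R ?e)"
        using MVT2[OF \<tau>(1) dl] by blast
      then have "q n x = pderiv_at i h (x + z *\<^sub>R ?e)" using \<tau>(1) unfolding q_def \<tau>_def[symmetric] by simp
      then have qM: "\<bar>q n x\<bar> \<le> M" using M by simp
      show "norm (q n x) \<le> M * indicator (cball 0 (R + 1)) x"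
      proof (cases "norm x \<le> R + 1")
        case True then show ?thesis using qM by (simp add: dist_norm)
      next
        case False
        have "norm x \<le> norm (x + \<tau> *\<^sub>R ?e) + norm (\<tau> *\<^sub>R ?e)"
          using norm_triangle_ineq4[of "x + \<tau> *\<^sub>R ?e" "\<tau> *\<^sub>R ?e"] by simp
        then have "norm x \<le> norm (x + \<tau> *\<^sub>R ?e) + 1" using \<tau> by (simp add: norm_axis_1)
        then have "x \<notin> K" "x + \<tau> *\<^sub>R ?e \<notin> K" using R[of x] R[of "x + \<tau> *\<^sub>R ?e"] False by auto
        then show ?thesis using K(2) False unfolding q_def \<tau>_def[symmetric] by (simp add: dist_norm)
      qed
    qed
  qed
  moreover have "(LINT x|lborel. q n x) = 0" for n
  proof -
    let ?c = "(1 / real (Suc n)) *\<^sub>R ?e"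
    have tr: "integrable lborel (\<lambda>x. h (x + ?c))" "(LINT x|lborel. h (x + ?c)) = (LINT x|lborel. h x)"
    proof -
      have "integrable (distr lborel borel ((+) ?c)) h" using ih(1) by (simp only: lborel_distr_plus)
      then have "integrable lborel (\<lambda>x. h (?c + x))"
        by (rule integrable_distr_eq[THEN iffD1, rotated 2]) (use ih(2) in auto)
      then show "integrable lborel (\<lambda>x. h (x + ?c))" by (simp only: add.commute)
      have "(LINT x|lborel. h (?c + x)) = integral\<^sup>L (distr lborel borel ((+) ?c)) h"
        by (rule integral_distr[symmetric]) (use ih(2) in auto)
      then show "(LINT x|lborel. h (x + ?c)) = (LINT x|lborel. h x)"
        by (simp only: lborel_distr_plus add.commute)
    qed
    then show ?thesis using ih(1) by (simp add: q_def)
  qed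
  ultimately show ?thesis by (simp add: LIMSEQ_const_iff)
qed

text \<open>The product rule, as the derivative of the compactly supported product integrates to
  zero.\<close>

lemma integration_by_parts_test:
  assumes \<phi>: "test_function \<Omega> \<phi>" and \<psi>: "test_function \<Omega> \<psi>"
  shows "(LINT x|lborel. pderiv_at i \<phi> x * \<psi> x) = - (LINT x|lborel. \<phi> x * pderiv_at i \<psi> x)"
proof -
  obtain K where K: "compact K" "K \<subseteq> \<Omega>" "\<And>x. x \<notin> K \<Longrightarrow> \<phi> x = 0" "\<And>x i. x \<notin> K \<Longrightarrow> pderiv_at i \<phi> x = 0"
    "continuous_on UNIV \<phi>" "\<And>i. continuous_on UNIV (pderiv_at i \<phi>)" "\<And>x. \<phi> differentiable (at x)"
    using test_functionE[OF \<phi>] by metis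
  obtain L where L: "continuous_on UNIV \<psi>" "\<And>i. continuous_on UNIV (pderiv_at i \<psi>)" "\<And>x. \<psi> differentiable (at x)"
    using test_functionE[OF \<psi>] by metis
  have pd: "pderiv_at i (\<lambda>x. \<phi> x * \<psi> x) = (\<lambda>x. \<phi> x * pderiv_at i \<psi> x + pderiv_at i \<phi> x * \<psi> x)"
  proof
    fix x
    have "((\<lambda>x. \<phi> x * \<psi> x) has_derivative
        (\<lambda>h. \<phi> x * frechet_derivative \<psi> (at x) h + frechet_derivative \<phi> (at x) h * \<psi> x)) (at x)"
      using K(7) L(3) frechet_derivative_works by (intro has_derivative_mult) blast+
    from pderiv_at_eq[OF this] show "pderiv_at i (\<lambda>x. \<phi> x * \<psi> x) x = \<phi> x * pderiv_at i \<psi> x + pderiv_at i \<phi> x * \<psi> x"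
      by (simp add: pderiv_at_def)
  qed
  have "(LINT x|lborel. pderiv_at i (\<lambda>x. \<phi> x * \<psi> x) x) = 0"
  proof (rule integral_pderiv_at_zero)
    show "(\<lambda>x. \<phi> x * \<psi> x) differentiable (at x)" for x using K(7) L(3) by (rule differentiable_mult)
    show "continuous_on UNIV (pderiv_at i (\<lambda>x. \<phi> x * \<psi> x))"
      unfolding pd by (intro continuous_intros K L)
  qed (use K in auto)
  moreover have "integrable lborel (\<lambda>x. \<phi> x * pderiv_at i \<psi> x)"
    by (rule continuous_compact_support_integrable(1)[OF _ K(1)]) (auto intro!: continuous_intros K L simp: K)
  moreover have "integrable lborel (\<lambda>x. pderiv_at i \<phi> x * \<psi> x)"
    by (rule continuous_compact_support_integrable(1)[OF _ K(1)]) (auto intro!: continuous_intros K L simp: K)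
  ultimately show ?thesis unfolding pd by simp
qed

section \<open>The Euler--Lagrange equation\<close>

lemma grad_nth [simp]: "grad \<phi> x $ i = pderiv_at i \<phi> x"
  by (simp add: grad_def)

lemma continuous_on_grad:
  assumes "\<And>i. continuous_on UNIV (pderiv_at i \<phi>)"
  shows "continuous_on UNIV (grad \<phi>)"
  unfolding grad_def by (rule continuous_on_vec_lambda) (rule assms)

lemma grad_test_functionE:
  assumes "test_function \<Omega> \<phi>"
  obtains K where "compact K" "K \<subseteq> \<Omega>" "\<And>x. x \<notin> K \<Longrightarrow> grad \<phi> x = 0"
    "continuous_on UNIV (grad \<phi>)" "integrable lebesgue (grad \<phi>)"
proof -
  obtain K where K: "compact K" "K \<subseteq> \<Omega>" "\<And>x i. x \<notin> K \<Longrightarrow> pderiv_at i \<phi> x = 0"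
    "\<And>i. continuous_on UNIV (pderiv_at i \<phi>)"
    using test_functionE[OF assms] by metis
  have z: "grad \<phi> x = 0" if "x \<notin> K" for x using K(3)[OF that] by (simp add: plane_eq_iff)
  have c: "continuous_on UNIV (grad \<phi>)" by (rule continuous_on_grad[OF K(4)])
  have "integrable lebesgue (grad \<phi>)"
    by (rule continuous_compact_support_integrable(2)[OF c K(1)]) (rule z)
  then show ?thesis using that K(1,2) z c by blast
qed

lemma integrable_mult_bounded_right:
  fixes g :: "plane \<Rightarrow> real"
  assumes "set_integrable lebesgue \<Omega> u" "g \<in> borel_measurable borel" "\<And>x. \<bar>g x\<bar> \<le> M"
  shows "set_integrable lebesgue \<Omega> (\<lambda>x. u x * g x)"
proof -
  have "integrable lebesgue (\<lambda>x. M * (indicator \<Omega> x * u x))"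
    using assms(1) by (auto simp: set_integrable_def)
  then have "integrable lebesgue (\<lambda>x. indicator \<Omega> x * u x * g x)"
  proof (rule Bochner_Integration.integrable_bound)
    have "(\<lambda>x. indicator \<Omega> x * u x) \<in> borel_measurable lebesgue"
      using assms(1) by (auto simp: set_integrable_def)
    moreover have "g \<in> borel_measurable lebesgue"
      using assms(2) by (rule measurable_completion[of g lborel, simplified])
    ultimately show "(\<lambda>x. indicator \<Omega> x * u x * g x) \<in> borel_measurable lebesgue" by simp
    have "M \<ge> 0" using assms(3)[of 0] by (meson abs_ge_zero order_trans)
    then show "AE x in lebesgue. norm (indicator \<Omega> x * u x * g x) \<le> norm (M * (indicator \<Omega> x * u x))"
      using assms(3) by (intro AE_I2) (simp add: abs_mult mult.commute[of M] mult_left_mono)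
  qed
  then show ?thesis by (simp add: set_integrable_def mult.assoc)
qed

lemma bounded_of_compact_support:
  fixes g :: "plane \<Rightarrow> real"
  assumes "continuous_on UNIV g" "compact K" "\<And>x. x \<notin> K \<Longrightarrow> g x = 0"
  obtains M where "\<And>x. \<bar>g x\<bar> \<le> M"
proof -
  have "bounded (g ` K)"
    using compact_continuous_image[OF continuous_on_subset[OF assms(1)] assms(2)] compact_imp_bounded by blast
  then obtain M0 where M0: "\<And>x. x \<in> K \<Longrightarrow> \<bar>g x\<bar> \<le> M0" by (auto simp: bounded_iff)
  have "\<bar>g x\<bar> \<le> max M0 0" for x using M0[of x] assms(3)[of x] by (cases "x \<in> K") auto
  then show ?thesis by (rule that)
qed

text \<open>Integration by parts turns the added density into the weak derivative of the added
  function. As \<open>m'\<close> is prescribed on Borel sets alone, the lemma serves both for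
  membership in BV and for the splitting of the gradient into \<sigma> and \<open>p\<close>.\<close>

lemma has_gradient_measure_perturb:
  assumes m: "has_gradient_measure \<Omega> u m" and u: "set_integrable lebesgue \<Omega> u"
    and \<phi>: "test_function \<Omega> \<phi>"
    and m': "\<And>B. B \<in> sets borel \<Longrightarrow> m' B = m B + t *\<^sub>R (LINT x:B|lebesgue. grad \<phi> x)"
  shows "has_gradient_measure \<Omega> (\<lambda>x. u x + t * \<phi> x) m'"
  unfolding has_gradient_measure_def
proof (intro allI impI)
  fix \<psi> i assume \<psi>: "test_function \<Omega> \<psi>"
  obtain K where K: "compact K" "K \<subseteq> \<Omega>" "\<And>x. x \<notin> K \<Longrightarrow> \<phi> x = 0" "\<And>x i. x \<notin> K \<Longrightarrow> pderiv_at i \<phi> x = 0"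
    "continuous_on UNIV \<phi>" "\<And>i. continuous_on UNIV (pderiv_at i \<phi>)"
    using test_functionE[OF \<phi>] by metis
  obtain L where L: "compact L" "L \<subseteq> \<Omega>" "\<And>x. x \<notin> L \<Longrightarrow> \<psi> x = 0" "\<And>x i. x \<notin> L \<Longrightarrow> pderiv_at i \<psi> x = 0"
    "continuous_on UNIV \<psi>" "\<And>i. continuous_on UNIV (pderiv_at i \<psi>)"
    using test_functionE[OF \<psi>] by metis
  have ig: "integrable lebesgue (grad \<phi>)" using grad_test_functionE[OF \<phi>] by metis
  define h where "h x = t * pderiv_at i \<phi> x" for x
  have ih: "integrable lborel h" unfolding h_def
    by (rule continuous_compact_support_integrable(1)[OF _ K(1)]) (auto intro!: continuous_intros K simp: K)
  have hb: "h \<in> borel_measurable borel" using ih by simp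
  have comp: "(LINT x:B|lebesgue. grad \<phi> x) $ i = (LINT x:B|lborel. pderiv_at i \<phi> x)"
    if B: "B \<in> sets borel" for B
  proof -
    have "integrable lebesgue (\<lambda>x. indicator B x *\<^sub>R grad \<phi> x)"
      by (rule integrable_mult_indicator[OF _ ig]) (use B in auto)
    from integral_bounded_linear[OF bounded_linear_vec_nth this, of i]
    have "(LINT x:B|lebesgue. grad \<phi> x) $ i = (LINT x|lebesgue. indicator B x * pderiv_at i \<phi> x)"
      by (simp add: set_lebesgue_integral_def)
    also have "\<dots> = (LINT x|lborel. indicator B x * pderiv_at i \<phi> x)"
      by (rule integral_completion)
        (use B borel_measurable_continuous_onI[OF K(6)] in auto)
    finally show ?thesis by (simp add: set_lebesgue_integral_def)
  qed
  have "has_signed_integral (\<lambda>B. m' B $ i) \<psi>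
      (- (LINT x:\<Omega>|lebesgue. u x * pderiv_at i \<psi> x) + (LINT x|lborel. h x * \<psi> x))"
  proof (rule has_signed_integral_add_density[OF _ ih])
    show "has_signed_integral (\<lambda>B. m B $ i) \<psi> (- (LINT x:\<Omega>|lebesgue. u x * pderiv_at i \<psi> x))"
      using m \<psi> unfolding has_gradient_measure_def by blast
    show "\<psi> \<in> borel_measurable borel" using L(5) by (rule borel_measurable_continuous_onI)
    show "integrable lborel (\<lambda>x. h x * \<psi> x)" unfolding h_def
      by (rule continuous_compact_support_integrable(1)[OF _ K(1)]) (auto intro!: continuous_intros K L simp: K)
    show "m' B $ i = m B $ i + (LINT x:B|lborel. h x)" if "B \<in> sets borel" for B
      using m'[OF that] comp[OF that] by (simp add: h_def)
  qed
  moreover have "(LINT x|lborel. h x * \<psi> x) = - t * (LINT x|lborel. \<phi> x * pderiv_at i \<psi> x)"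
    using integration_by_parts_test[OF \<phi> \<psi>, of i] by (simp add: h_def mult.assoc)
  moreover have "(LINT x|lborel. \<phi> x * pderiv_at i \<psi> x) = (LINT x:\<Omega>|lebesgue. \<phi> x * pderiv_at i \<psi> x)"
    and i2: "set_integrable lebesgue \<Omega> (\<lambda>x. \<phi> x * pderiv_at i \<psi> x)"
  proof -
    have c: "continuous_on UNIV (\<lambda>x. \<phi> x * pderiv_at i \<psi> x)" by (intro continuous_intros K L)
    have z: "x \<notin> K \<Longrightarrow> \<phi> x * pderiv_at i \<psi> x = 0" for x by (simp add: K)
    have ci: "integrable lebesgue (\<lambda>x. \<phi> x * pderiv_at i \<psi> x)"
      "(\<lambda>x. \<phi> x * pderiv_at i \<psi> x) \<in> borel_measurable borel"
      by (rule continuous_compact_support_integrable[OF c K(1)], erule z)+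
    have eq: "(\<lambda>x. indicator \<Omega> x *\<^sub>R (\<phi> x * pderiv_at i \<psi> x)) = (\<lambda>x. \<phi> x * pderiv_at i \<psi> x)"
      using K(2,3) by (force simp: indicator_def)
    show "set_integrable lebesgue \<Omega> (\<lambda>x. \<phi> x * pderiv_at i \<psi> x)"
      using ci(1) by (simp only: set_integrable_def eq)
    show "(LINT x|lborel. \<phi> x * pderiv_at i \<psi> x) = (LINT x:\<Omega>|lebesgue. \<phi> x * pderiv_at i \<psi> x)"
      unfolding set_lebesgue_integral_def eq using ci(2) by (intro integral_completion[symmetric]) simp
  qed
  moreover have "set_integrable lebesgue \<Omega> (\<lambda>x. u x * pderiv_at i \<psi> x)"
  proof -
    obtain M where "\<And>x. \<bar>pderiv_at i \<psi> x\<bar> \<le> M"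
      using bounded_of_compact_support[OF L(6) L(1) L(4)] by metis
    then show ?thesis
      by (intro integrable_mult_bounded_right[OF u borel_measurable_continuous_onI[OF L(6)]])
  qed
  then have "(LINT x:\<Omega>|lebesgue. (u x + t * \<phi> x) * pderiv_at i \<psi> x)
      = (LINT x:\<Omega>|lebesgue. u x * pderiv_at i \<psi> x) + t * (LINT x:\<Omega>|lebesgue. \<phi> x * pderiv_at i \<psi> x)"
    using i2 by (simp add: distrib_right mult.assoc set_integral_add)
  ultimately show "has_signed_integral (\<lambda>B. m' B $ i) \<psi>
      (- (LINT x:\<Omega>|lebesgue. (u x + t * \<phi> x) * pderiv_at i \<psi> x))"
    by simp
qed

lemma vector_measure_add_density:
  assumes m: "vector_measure m" and F: "integrable lebesgue F"
  shows "vector_measure (\<lambda>B. m B + (LINT x:B|lebesgue. F x))"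
proof -
  define N where "N B = (LINT x:B|lebesgue. F x)" for B
  \<comment> \<open>Used twice: it makes the series of values absolutely summable, and it bounds the
    variation.\<close>
  have part: "(\<Sum>k<n. norm (N (B k))) \<le> (LINT x|lebesgue. norm (F x))"
    if B: "range B \<subseteq> sets borel" "disjoint_family B" for B :: "nat \<Rightarrow> plane set" and n
  proof -
    have Bs: "B k \<in> sets lebesgue" for k using B(1) by auto
    have i: "integrable lebesgue (\<lambda>x. indicator (B k) x *\<^sub>R norm (F x))" for k
      by (rule integrable_mult_indicator[OF Bs]) (use F in auto)
    have "(\<Sum>k<n. norm (N (B k))) \<le> (\<Sum>k<n. (LINT x|lebesgue. indicator (B k) x *\<^sub>R norm (F x)))"
    proof (rule sum_mono)
      fix k
      have "norm (N (B k)) \<le> (LINT x|lebesgue. norm (indicator (B k) x *\<^sub>R F x))"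
        unfolding N_def set_lebesgue_integral_def by (rule integral_norm_bound)
      then show "norm (N (B k)) \<le> (LINT x|lebesgue. indicator (B k) x *\<^sub>R norm (F x))" by simp
    qed
    also have "\<dots> = (LINT x|lebesgue. (\<Sum>k<n. indicator (B k) x *\<^sub>R norm (F x)))"
      by (rule Bochner_Integration.integral_sum[symmetric]) (rule i)
    also have "\<dots> \<le> (LINT x|lebesgue. norm (F x))"
    proof (rule integral_mono)
      show "integrable lebesgue (\<lambda>x. \<Sum>k<n. indicator (B k) x *\<^sub>R norm (F x))"
        by (rule Bochner_Integration.integrable_sum) (rule i)
      show "integrable lebesgue (\<lambda>x. norm (F x))" using F by simp
      fix x
      have "disjoint_family_on B {..<n}"
        using B(2) by (rule disjoint_family_on_mono[rotated]) simp
      then have "(\<Sum>k<n. indicator (B k) x *\<^sub>R norm (F x)) = indicator (\<Union>k<n. B k) x * norm (F x)"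
        by (simp add: indicator_UN_disjoint sum_distrib_right)
      also have "\<dots> \<le> norm (F x)" by (simp add: indicator_def)
      finally show "(\<Sum>k<n. indicator (B k) x *\<^sub>R norm (F x)) \<le> norm (F x)" .
    qed
    finally show ?thesis .
  qed
  have sums: "(\<lambda>n. N (B n)) sums N (\<Union>n. B n)" if B: "range B \<subseteq> sets borel" "disjoint_family B" for B
  proof -
    have Bs: "B k \<in> sets lebesgue" for k using B(1) by auto
    have "set_integrable lebesgue (\<Union>n. B n) F"
      unfolding set_integrable_def by (rule integrable_mult_indicator[OF _ F]) (use Bs in auto)
    then have "N (\<Union>n. B n) = (\<Sum>n. N (B n))"
      unfolding N_def using Bs B(2) by (intro lebesgue_integral_countable_add) (auto simp: disjoint_family_on_def)
    moreover have "summable (\<lambda>n. norm (N (B n)))"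
      by (rule summableI_nonneg_bounded[OF norm_ge_zero part[OF B]])
    ultimately show ?thesis using summable_norm_cancel summable_sums by metis
  qed
  have "variation (\<lambda>B. m B + N B) UNIV \<le> variation m UNIV + ennreal (LINT x|lebesgue. norm (F x))"
    unfolding variation_def[of "\<lambda>B. m B + N B"]
  proof (rule SUP_least)
    fix B assume "B \<in> {B :: nat \<Rightarrow> plane set. range B \<subseteq> sets borel \<and> disjoint_family B \<and> (\<Union>n. B n) = UNIV}"
    then have B: "range B \<subseteq> sets borel" "disjoint_family B" "(\<Union>n. B n) = UNIV" by auto
    have "(\<Sum>n. ennreal (norm (m (B n) + N (B n)))) \<le> (\<Sum>n. ennreal (norm (m (B n))) + ennreal (norm (N (B n))))"
      by (intro suminf_le summableI) (simp add: ennreal_plus[symmetric] norm_triangle_ineq del: ennreal_plus)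
    also have "\<dots> = (\<Sum>n. ennreal (norm (m (B n)))) + (\<Sum>n. ennreal (norm (N (B n))))"
      by (intro suminf_add[symmetric] summableI)
    also have "\<dots> \<le> variation m UNIV + ennreal (LINT x|lebesgue. norm (F x))"
    proof (rule add_mono)
      show "(\<Sum>n. ennreal (norm (m (B n)))) \<le> variation m UNIV"
        unfolding variation_def by (rule SUP_upper) (use B in auto)
      show "(\<Sum>n. ennreal (norm (N (B n)))) \<le> ennreal (LINT x|lebesgue. norm (F x))"
        by (intro suminf_le_const summableI) (simp add: sum_ennreal ennreal_leI part[OF B(1,2)])
    qed
    finally show "(\<Sum>n. ennreal (norm (m (B n) + N (B n)))) \<le> variation m UNIV + ennreal (LINT x|lebesgue. norm (F x))" .
  qed
  also have "\<dots> < \<infinity>" using m by (auto simp: vector_measure_def)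
  finally show ?thesis
    using m sums unfolding vector_measure_def N_def by (auto intro: sums_add)
qed

text \<open>A partition of \<open>A\<close> becomes a partition of the plane when the complement of
  \<open>A\<close> is put in front as member 0, which can only enlarge the sum.\<close>

lemma variation_finite:
  assumes "vector_measure p" "A \<in> sets borel"
  shows "variation p A < \<infinity>"
proof -
  have "variation p A \<le> variation p UNIV"
    unfolding variation_def[of p A]
  proof (rule SUP_least)
    fix B assume "B \<in> {B :: nat \<Rightarrow> plane set. range B \<subseteq> sets borel \<and> disjoint_family B \<and> (\<Union>n. B n) = A}"
    then have B: "range B \<subseteq> sets borel" "disjoint_family B" "(\<Union>n. B n) = A" by auto
    define B' where "B' n = (case n of 0 \<Rightarrow> - A | Suc k \<Rightarrow> B k)" for n
    have sub: "B k \<subseteq> A" for k using B(3) by auto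
    have "range B' \<subseteq> sets borel" using B(1) assms(2) by (auto simp: B'_def split: nat.split)
    moreover have "disjoint_family B'"
      unfolding disjoint_family_on_def
    proof (intro ballI impI)
      fix i j :: nat assume "i \<noteq> j"
      then show "B' i \<inter> B' j = {}"
        using B(2) sub by (cases i; cases j) (auto simp: B'_def disjoint_family_on_def)
    qed
    moreover have "(\<Union>n. B' n) = UNIV"
    proof -
      have "x \<in> (\<Union>n. B' n)" for x
      proof (cases "x \<in> A")
        case True
        then obtain k where "x \<in> B k" using B(3) by auto
        then have "x \<in> B' (Suc k)" by (simp add: B'_def)
        then show ?thesis by blast
      next
        case False
        then have "x \<in> B' 0" by (simp add: B'_def)
        then show ?thesis by blast
      qed
      then show ?thesis by blast
    qed
    ultimately have le: "(\<Sum>n. ennreal (norm (p (B' n)))) \<le> variation p UNIV"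
      unfolding variation_def by (intro SUP_upper) auto
    have "(\<Sum>n. ennreal (norm (p (B n)))) = (\<Sum>n. ennreal (norm (p (B' (n + 1)))))"
      by (simp add: B'_def)
    also have "\<dots> \<le> (\<Sum>n. ennreal (norm (p (B' (n + 1))))) + (\<Sum>n<1. ennreal (norm (p (B' n))))"
      by (rule add_increasing2) auto
    also have "\<dots> = (\<Sum>n. ennreal (norm (p (B' n))))"
      by (rule suminf_offset[symmetric]) (rule summableI)
    finally show "(\<Sum>n. ennreal (norm (p (B n)))) \<le> variation p UNIV" using le by (rule order_trans)
  qed
  also have "\<dots> < \<infinity>" using assms by (simp add: vector_measure_def)
  finally show ?thesis .
qed

lemma norm_add_scaleR_sq:
  "(norm (a + t *\<^sub>R b))\<^sup>2 = (norm a)\<^sup>2 + ((2 * t) * (a \<bullet> b) + t\<^sup>2 * (norm b)\<^sup>2)"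
  for a b :: "'a::real_inner"
  unfolding power2_norm_eq_inner
  by (simp add: inner_add_left inner_add_right inner_commute[of b a] power2_eq_square algebra_simps)

lemma L2_on_perturb:
  assumes \<sigma>: "L2_on \<Omega> \<sigma>" and \<Omega>: "open \<Omega>" and G: "continuous_on UNIV G" "compact K" "\<And>x. x \<notin> K \<Longrightarrow> G x = (0::plane)"
  shows "L2_on \<Omega> (\<lambda>x. \<sigma> x + t *\<^sub>R G x)"
    and "set_integrable lebesgue \<Omega> (\<lambda>x. \<sigma> x \<bullet> G x)"
    and "set_integrable lebesgue \<Omega> (\<lambda>x. (norm (G x))\<^sup>2)"
proof -
  have \<Omega>s: "\<Omega> \<in> sets lebesgue" using \<Omega> by auto
  have ms: "(\<lambda>x. indicator \<Omega> x *\<^sub>R \<sigma> x) \<in> borel_measurable lebesgue"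
    and iS: "integrable lebesgue (\<lambda>x. indicator \<Omega> x * (norm (\<sigma> x))\<^sup>2)"
    using \<sigma> by (simp_all add: L2_on_def set_borel_measurable_def set_integrable_def)
  have mG: "G \<in> borel_measurable lebesgue"
    using G(1) by (intro measurable_completion) (simp add: borel_measurable_continuous_onI)
  have c2: "continuous_on UNIV (\<lambda>x. (norm (G x))\<^sup>2)" by (intro continuous_intros G(1))
  have "integrable lebesgue (\<lambda>x. (norm (G x))\<^sup>2)"
    by (rule continuous_compact_support_integrable(2)[OF c2 G(2)]) (simp add: G(3))
  from integrable_mult_indicator[OF \<Omega>s this]
  have iG: "integrable lebesgue (\<lambda>x. indicator \<Omega> x * (norm (G x))\<^sup>2)" by simp
  then show "set_integrable lebesgue \<Omega> (\<lambda>x. (norm (G x))\<^sup>2)" by (simp add: set_integrable_def)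
  have m\<Omega>: "(indicator \<Omega> :: plane \<Rightarrow> real) \<in> borel_measurable lebesgue" using \<Omega>s by simp
  have young: "\<bar>a \<bullet> b\<bar> \<le> (norm a)\<^sup>2 + (norm b)\<^sup>2" for a b :: plane
  proof -
    have "\<bar>a \<bullet> b\<bar> \<le> norm a * norm b" by (rule Cauchy_Schwarz_ineq2)
    also have "\<dots> \<le> (norm a)\<^sup>2 + (norm b)\<^sup>2"
    proof -
      have "2 * (norm a * norm b) \<le> (norm a)\<^sup>2 + (norm b)\<^sup>2"
        using sum_squares_bound[of "norm a" "norm b"] by (simp add: mult.assoc)
      moreover have "0 \<le> norm a * norm b" by simp
      ultimately show ?thesis by linarith
    qed
    finally show ?thesis .
  qed
  have "integrable lebesgue (\<lambda>x. indicator \<Omega> x * (\<sigma> x \<bullet> G x))"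
  proof (rule Bochner_Integration.integrable_bound[OF Bochner_Integration.integrable_add[OF iS iG]])
    have "(\<lambda>x. (indicator \<Omega> x *\<^sub>R \<sigma> x) \<bullet> G x) \<in> borel_measurable lebesgue"
      using ms mG by (rule borel_measurable_inner)
    then show "(\<lambda>x. indicator \<Omega> x * (\<sigma> x \<bullet> G x)) \<in> borel_measurable lebesgue" by simp
    show "AE x in lebesgue. norm (indicator \<Omega> x * (\<sigma> x \<bullet> G x))
        \<le> norm (indicator \<Omega> x * (norm (\<sigma> x))\<^sup>2 + indicator \<Omega> x * (norm (G x))\<^sup>2)"
      by (rule AE_I2) (use young in \<open>auto simp: indicator_def\<close>)
  qed
  then show i3: "set_integrable lebesgue \<Omega> (\<lambda>x. \<sigma> x \<bullet> G x)" by (simp add: set_integrable_def)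
  show "L2_on \<Omega> (\<lambda>x. \<sigma> x + t *\<^sub>R G x)"
    unfolding L2_on_def
  proof
    have "(\<lambda>x. indicator \<Omega> x *\<^sub>R \<sigma> x + (t * indicator \<Omega> x) *\<^sub>R G x) \<in> borel_measurable lebesgue"
      using ms mG m\<Omega> by simp
    then show "set_borel_measurable lebesgue \<Omega> (\<lambda>x. \<sigma> x + t *\<^sub>R G x)"
      by (simp add: set_borel_measurable_def algebra_simps)
    show "set_integrable lebesgue \<Omega> (\<lambda>x. (norm (\<sigma> x + t *\<^sub>R G x))\<^sup>2)"
      unfolding norm_add_scaleR_sq using \<sigma> i3 iG
      by (intro set_integral_add set_integrable_mult_right) (simp_all add: L2_on_def set_integrable_def)
  qed
qed

lemma L2_on_integrable:
  fixes \<sigma> :: "plane \<Rightarrow> plane"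
  assumes \<sigma>: "L2_on \<Omega> \<sigma>" and \<Omega>: "open \<Omega>" "bounded \<Omega>"
  shows "set_integrable lebesgue \<Omega> \<sigma>"
proof -
  have "emeasure lebesgue \<Omega> < \<infinity>" using \<Omega> emeasure_bounded_finite[of \<Omega>] by simp
  then have "integrable lebesgue (indicator \<Omega> :: plane \<Rightarrow> real)"
    using \<Omega> by (intro integrable_real_indicator) auto
  moreover have "integrable lebesgue (\<lambda>x. indicator \<Omega> x * (norm (\<sigma> x))\<^sup>2)"
    using \<sigma> by (simp add: L2_on_def set_integrable_def)
  ultimately have "integrable lebesgue (\<lambda>x. indicator \<Omega> x + indicator \<Omega> x * (norm (\<sigma> x))\<^sup>2)" by simp
  then show ?thesis unfolding set_integrable_def
  proof (rule Bochner_Integration.integrable_bound)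
    show "(\<lambda>x. indicator \<Omega> x *\<^sub>R \<sigma> x) \<in> borel_measurable lebesgue"
      using \<sigma> by (simp add: L2_on_def set_borel_measurable_def)
    have "norm a \<le> 1 + (norm a)\<^sup>2" for a :: plane
    proof -
      have "2 * norm a \<le> (norm a)\<^sup>2 + 1" using sum_squares_bound[of "norm a" 1] by simp
      then show ?thesis using norm_ge_zero[of a] by linarith
    qed
    then show "AE x in lebesgue. norm (indicator \<Omega> x *\<^sub>R \<sigma> x)
        \<le> norm (indicator \<Omega> x + indicator \<Omega> x * (norm (\<sigma> x))\<^sup>2 :: real)"
      by (intro AE_I2) (auto simp: indicator_def)
  qed
qed

text \<open>Near a boundary point \<phi> vanishes, so the averages for small \<open>r\<close> are
  unchanged and \<open>g\<close> remains a trace.\<close>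

lemma has_trace_perturb:
  assumes g: "has_trace \<Omega> u g" and \<Omega>: "open \<Omega>" and K: "compact K" "K \<subseteq> \<Omega>" "\<And>x. x \<notin> K \<Longrightarrow> \<phi> x = 0"
  shows "has_trace \<Omega> (\<lambda>x. u x + t * \<phi> x) g"
proof -
  have key: "((\<lambda>r. (LINT y:\<Omega> \<inter> ball x r|lebesgue. \<bar>u y + t * \<phi> y - g x\<bar>) / r\<^sup>2) \<longlongrightarrow> 0) (at_right 0)"
    if l: "((\<lambda>r. (LINT y:\<Omega> \<inter> ball x r|lebesgue. \<bar>u y - g x\<bar>) / r\<^sup>2) \<longlongrightarrow> 0) (at_right 0)"
      and x: "x \<in> frontier \<Omega>" for x
  proof -
    have "x \<in> - K" using x K(2) \<Omega> by (auto simp: frontier_def interior_open)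
    moreover have "open (- K)" using K(1) by (simp add: compact_imp_closed open_Compl)
    ultimately obtain d where d: "d > 0" "ball x d \<subseteq> - K" using open_contains_ball by blast
    have "(LINT y:\<Omega> \<inter> ball x r|lebesgue. \<bar>u y - g x\<bar>) = (LINT y:\<Omega> \<inter> ball x r|lebesgue. \<bar>u y + t * \<phi> y - g x\<bar>)"
      if "r < d" for r
    proof -
      have "\<phi> y = 0" if "y \<in> ball x r" for y
      proof -
        have "y \<in> ball x d" using that \<open>r < d\<close> by auto
        then show ?thesis using d(2) K(3)[of y] by blast
      qed
      then show ?thesis unfolding set_lebesgue_integral_def
        by (intro Bochner_Integration.integral_cong refl) (simp add: indicator_def)
    qed
    then have "eventually (\<lambda>r. (LINT y:\<Omega> \<inter> ball x r|lebesgue. \<bar>u y - g x\<bar>) / r\<^sup>2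
        = (LINT y:\<Omega> \<inter> ball x r|lebesgue. \<bar>u y + t * \<phi> y - g x\<bar>) / r\<^sup>2) (at_right 0)"
      using d(1) by (intro eventually_at_rightI[of 0 d]) auto
    from tendsto_cong[OF this] l show ?thesis by blast
  qed
  have "AE x in hausdorff1. x \<in> frontier \<Omega> \<longrightarrow>
      ((\<lambda>r. (LINT y:\<Omega> \<inter> ball x r|lebesgue. \<bar>u y - g x\<bar>) / r\<^sup>2) \<longlongrightarrow> 0) (at_right 0)"
    using g by (simp add: has_trace_def)
  then have "AE x in hausdorff1. x \<in> frontier \<Omega> \<longrightarrow>
      ((\<lambda>r. (LINT y:\<Omega> \<inter> ball x r|lebesgue. \<bar>u y + t * \<phi> y - g x\<bar>) / r\<^sup>2) \<longlongrightarrow> 0) (at_right 0)"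
    by eventually_elim (use key in blast)
  then show ?thesis using g by (simp add: has_trace_def)
qed

text \<open>The perturbation lives in a compact subset of \<Omega>: traces and \<open>p\<close> stay
  as they were, and the gradient of \<phi> is absorbed by \<sigma>.\<close>

lemma admissible_perturb:
  assumes adm: "admissible \<Omega> w u \<sigma> p" and \<Omega>: "open \<Omega>" "bounded \<Omega>" and \<phi>: "test_function \<Omega> \<phi>"
  shows "admissible \<Omega> w (\<lambda>x. u x + t * \<phi> x) (\<lambda>x. \<sigma> x + t *\<^sub>R grad \<phi> x) p"
proof -
  obtain K where K: "compact K" "K \<subseteq> \<Omega>" "\<And>x. x \<notin> K \<Longrightarrow> \<phi> x = 0" and cont: "continuous_on UNIV \<phi>"
    using test_functionE[OF \<phi>] by metis
  obtain L where L: "compact L" "L \<subseteq> \<Omega>" "\<And>x. x \<notin> L \<Longrightarrow> grad \<phi> x = 0"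
    and cg: "continuous_on UNIV (grad \<phi>)" and ig: "integrable lebesgue (grad \<phi>)"
    using grad_test_functionE[OF \<phi>] by metis
  have \<sigma>: "L2_on \<Omega> \<sigma>" and u: "set_integrable lebesgue \<Omega> u"
    using adm by (auto simp: admissible_def BV_on_def)
  have "BV_on \<Omega> (\<lambda>x. u x + t * \<phi> x)"
    unfolding BV_on_def
  proof
    have "integrable lebesgue \<phi>"
      by (rule continuous_compact_support_integrable(2)[OF cont K(1)]) (rule K(3))
    then have "set_integrable lebesgue \<Omega> \<phi>"
      unfolding set_integrable_def using \<Omega> by (intro integrable_mult_indicator) auto
    then show "set_integrable lebesgue \<Omega> (\<lambda>x. u x + t * \<phi> x)"
      using u by (intro set_integral_add set_integrable_mult_right) auto
    obtain m where m: "vector_measure m" "has_gradient_measure \<Omega> u m"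
      using adm by (auto simp: admissible_def BV_on_def)
    let ?m = "\<lambda>B. m B + (LINT x:B|lebesgue. t *\<^sub>R grad \<phi> x)"
    have "vector_measure ?m" by (rule vector_measure_add_density[OF m(1)]) (use ig in simp)
    moreover have "has_gradient_measure \<Omega> (\<lambda>x. u x + t * \<phi> x) ?m"
      by (rule has_gradient_measure_perturb[OF m(2) u \<phi>]) simp
    ultimately show "\<exists>m. vector_measure m \<and> has_gradient_measure \<Omega> (\<lambda>x. u x + t * \<phi> x) m" by blast
  qed
  moreover have "has_gradient_measure \<Omega> (\<lambda>x. u x + t * \<phi> x)
      (\<lambda>B. (LINT x:B \<inter> \<Omega>|lebesgue. \<sigma> x + t *\<^sub>R grad \<phi> x) + p B)"
  proof (rule has_gradient_measure_perturb[OF _ u \<phi>])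
    show "has_gradient_measure \<Omega> u (\<lambda>B. (LINT x:B \<inter> \<Omega>|lebesgue. \<sigma> x) + p B)"
      using adm by (simp add: admissible_def)
    fix B :: "plane set" assume B: "B \<in> sets borel"
    have i1: "set_integrable lebesgue (B \<inter> \<Omega>) \<sigma>"
      by (rule set_integrable_subset[OF L2_on_integrable[OF \<sigma> \<Omega>]]) (use B \<Omega> in auto)
    have i2: "set_integrable lebesgue (B \<inter> \<Omega>) (\<lambda>x. t *\<^sub>R grad \<phi> x)"
      unfolding set_integrable_def by (rule integrable_mult_indicator) (use B \<Omega> ig in auto)
    have "(LINT x:B \<inter> \<Omega>|lebesgue. grad \<phi> x) = (LINT x:B|lebesgue. grad \<phi> x)"
      unfolding set_lebesgue_integral_def
      by (intro Bochner_Integration.integral_cong refl) (use L(2,3) in \<open>force simp: indicator_def\<close>)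
    then show "(LINT x:B \<inter> \<Omega>|lebesgue. \<sigma> x + t *\<^sub>R grad \<phi> x) + p B
        = (LINT x:B \<inter> \<Omega>|lebesgue. \<sigma> x) + p B + t *\<^sub>R (LINT x:B|lebesgue. grad \<phi> x)"
      using set_integral_add(2)[OF i1 i2] by simp
  qed
  moreover have "has_trace \<Omega> (\<lambda>x. u x + t * \<phi> x) g" if "has_trace \<Omega> u g" for g
    by (rule has_trace_perturb[OF that \<Omega>(1) K(1,2)]) (rule K(3))
  moreover have "L2_on \<Omega> (\<lambda>x. \<sigma> x + t *\<^sub>R grad \<phi> x)"
    by (rule L2_on_perturb(1)[OF \<sigma> \<Omega>(1) cg L(1)]) (rule L(3))
  ultimately show ?thesis using adm unfolding admissible_def by blast
qed

lemma minimizer_weakly_div_free: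
  assumes min: "minimizer \<Omega> w u \<sigma> p" and \<Omega>: "open \<Omega>" "bounded \<Omega>"
  shows "weakly_div_free \<Omega> \<sigma>"
  unfolding weakly_div_free_def
proof (intro allI impI)
  fix \<phi> assume \<phi>: "test_function \<Omega> \<phi>"
  obtain L where L: "compact L" "\<And>x. x \<notin> L \<Longrightarrow> grad \<phi> x = 0" and cg: "continuous_on UNIV (grad \<phi>)"
    using grad_test_functionE[OF \<phi>] by metis
  have adm: "admissible \<Omega> w u \<sigma> p" using min by (simp add: minimizer_def)
  then have \<sigma>: "L2_on \<Omega> \<sigma>" by (simp add: admissible_def)
  note pert = L2_on_perturb[OF \<sigma> \<Omega>(1) cg L(1)]
  define a where "a = (LINT x:\<Omega>|lebesgue. \<sigma> x \<bullet> grad \<phi> x)"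
  define b where "b = (LINT x:\<Omega>|lebesgue. (norm (grad \<phi> x))\<^sup>2)"
  define e where "e = (LINT x:\<Omega>|lebesgue. (norm (\<sigma> x))\<^sup>2)"
  have i: "set_integrable lebesgue \<Omega> (\<lambda>x. (norm (\<sigma> x))\<^sup>2)"
    "set_integrable lebesgue \<Omega> (\<lambda>x. \<sigma> x \<bullet> grad \<phi> x)"
    "set_integrable lebesgue \<Omega> (\<lambda>x. (norm (grad \<phi> x))\<^sup>2)"
    using \<sigma> pert(2,3) L(2) by (auto simp: L2_on_def)
  have E: "(LINT x:\<Omega>|lebesgue. (norm (\<sigma> x + t *\<^sub>R grad \<phi> x))\<^sup>2) = e + 2 * t * a + t\<^sup>2 * b" for t
  proof -
    have i2: "set_integrable lebesgue \<Omega> (\<lambda>x. (2 * t) * (\<sigma> x \<bullet> grad \<phi> x))"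
      "set_integrable lebesgue \<Omega> (\<lambda>x. t\<^sup>2 * (norm (grad \<phi> x))\<^sup>2)"
      using i by (auto intro: set_integrable_mult_right)
    show ?thesis
      unfolding norm_add_scaleR_sq
      using set_integral_add(2)[OF i(1) set_integral_add(1)[OF i2]] set_integral_add(2)[OF i2]
      by (simp add: a_def b_def e_def)
  qed
  have nn: "0 \<le> (LINT x:\<Omega>|lebesgue. (norm (f x))\<^sup>2)" for f :: "plane \<Rightarrow> plane"
    unfolding set_lebesgue_integral_def by (rule integral_nonneg_AE) auto
  have V: "variation p (closure \<Omega>) < \<infinity>"
    using adm by (intro variation_finite) (auto simp: admissible_def vector_measure_on_def)
  have quad: "0 \<le> 2 * t * a + t\<^sup>2 * b" for t
  proof -
    have "energy \<Omega> \<sigma> p \<le> energy \<Omega> (\<lambda>x. \<sigma> x + t *\<^sub>R grad \<phi> x) p"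
      using min admissible_perturb[OF adm \<Omega> \<phi>, of t] unfolding minimizer_def by blast
    \<comment> \<open>Energies are compared in \<open>ennreal\<close>: the variation of
      \<open>p\<close> is finite and cancels, and the perturbed integral is nonnegative, so it is
      not truncated.\<close>
    then have "variation p (closure \<Omega>) + ennreal (1/2 * e)
        \<le> variation p (closure \<Omega>) + ennreal (1/2 * (e + 2 * t * a + t\<^sup>2 * b))"
      by (simp only: energy_def E e_def[symmetric] add.commute)
    then have "ennreal (1/2 * e) \<le> ennreal (1/2 * (e + 2 * t * a + t\<^sup>2 * b))"
      using V by (simp only: ennreal_add_left_cancel_le) auto
    moreover have "0 \<le> 1/2 * (e + 2 * t * a + t\<^sup>2 * b)" using nn[of "\<lambda>x. \<sigma> x + t *\<^sub>R grad \<phi> x"] by (simp add: E)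
    ultimately have "1/2 * e \<le> 1/2 * (e + 2 * t * a + t\<^sup>2 * b)" by (simp only: ennreal_le_iff)
    then show ?thesis by simp
  qed
  have b0: "b \<ge> 0" unfolding b_def by (rule nn)
  have "a = 0"
  proof (rule ccontr)
    assume "a \<noteq> 0"
    \<comment> \<open>Essentially the minimum of the quadratic; the \<open>+ 1\<close> avoids
      division by zero when \<open>b\<close> is zero.\<close>
    have "0 \<le> 2 * (- a / (b + 1)) * a + (- a / (b + 1))\<^sup>2 * b" by (rule quad)
    also have "\<dots> = - (a\<^sup>2 * (b + 2)) / (b + 1)\<^sup>2"
      using b0 by (simp add: power2_eq_square divide_simps) (simp add: algebra_simps)
    also have "\<dots> < 0" using \<open>a \<noteq> 0\<close> b0 by (simp add: divide_less_0_iff zero_less_mult_iff)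
    finally show False by simp
  qed
  then show "(LINT x:\<Omega>|lebesgue. \<sigma> x \<bullet> grad \<phi> x) = 0" by (simp add: a_def)
qed

section \<open>Transfer to the continuous representative, and conclusion\<close>

lemma locally_lipschitz_on_continuous:
  assumes "locally_lipschitz_on U s" "open U"
  shows "continuous_on U s"
proof (rule continuous_at_imp_continuous_on, rule ballI)
  fix x assume x: "x \<in> U"
  then obtain r K where r: "r > 0" "K-lipschitz_on (ball x r \<inter> U) s"
    using assms(1) unfolding locally_lipschitz_on_def by blast
  have "continuous_on (ball x r \<inter> U) s" using r(2) by (rule lipschitz_on_continuous_on)
  then show "isCont s x"
    using assms(2) x r(1) by (auto simp: continuous_on_eq_continuous_at open_Int)
qed

text \<open>The exceptional set is open by continuity, and a nonempty open set is not
  negligible.\<close>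

lemma eq_on_open_if_AE:
  fixes f :: "plane \<Rightarrow> real"
  assumes U: "open U" and f: "continuous_on U f" and AE: "AE x in lebesgue. x \<in> U \<longrightarrow> f x = c" and x: "x \<in> U"
  shows "f x = c"
proof (rule ccontr)
  assume ne: "f x \<noteq> c"
  let ?S = "U \<inter> f -` (- {c})"
  have o: "open ?S" by (rule continuous_open_preimage[OF f U]) auto
  have "AE x in lebesgue. x \<notin> ?S" using AE by eventually_elim auto
  moreover have "?S \<in> sets lebesgue" using o by auto
  ultimately have "negligible ?S" by (simp add: negligible_iff_null_sets AE_iff_null_sets)
  then show False using open_not_negligible[OF o] ne x by blast
qed

text \<open>A test function on \<open>U\<close> is one on \<Omega>, and its gradient vanishes off
  \<open>U\<close>, where \<open>s\<close> and \<sigma> need not agree.\<close>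

lemma weakly_div_free_representative:
  assumes \<sigma>: "weakly_div_free \<Omega> \<sigma>" "L2_on \<Omega> \<sigma>" and \<Omega>: "open \<Omega>" "U \<subseteq> \<Omega>"
    and U: "open U" and s: "continuous_on U s" and AE: "AE x in lebesgue. x \<in> U \<longrightarrow> s x = \<sigma> x"
  shows "weakly_div_free U s"
  unfolding weakly_div_free_def
proof (intro allI impI)
  fix \<phi> assume \<phi>: "test_function U \<phi>"
  then have \<phi>': "test_function \<Omega> \<phi>" using \<Omega>(2) unfolding test_function_def by blast
  obtain L where L: "compact L" "L \<subseteq> U" "\<And>x. x \<notin> L \<Longrightarrow> grad \<phi> x = 0" and cg: "continuous_on UNIV (grad \<phi>)"
    using grad_test_functionE[OF \<phi>] by metis
  have "set_integrable lebesgue \<Omega> (\<lambda>x. \<sigma> x \<bullet> grad \<phi> x)"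
    by (rule L2_on_perturb(2)[OF \<sigma>(2) \<Omega>(1) cg L(1)]) (rule L(3))
  then have m1: "(\<lambda>x. indicator \<Omega> x *\<^sub>R (\<sigma> x \<bullet> grad \<phi> x)) \<in> borel_measurable lebesgue"
    by (auto simp: set_integrable_def)
  have "(\<lambda>x. indicator U x *\<^sub>R (s x \<bullet> grad \<phi> x)) \<in> borel_measurable borel"
    using U by (intro borel_measurable_continuous_on_indicator continuous_intros s continuous_on_subset[OF cg]) auto
  then have m2: "(\<lambda>x. indicator U x *\<^sub>R (s x \<bullet> grad \<phi> x)) \<in> borel_measurable lebesgue"
    by (intro measurable_completion) simp
  have "AE x in lebesgue. indicator U x *\<^sub>R (s x \<bullet> grad \<phi> x) = indicator \<Omega> x *\<^sub>R (\<sigma> x \<bullet> grad \<phi> x)"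
    using AE
  proof eventually_elim
    case (elim x)
    show ?case
    proof (cases "x \<in> U")
      case True then show ?thesis using elim \<Omega>(2) by (simp add: indicator_def subset_iff)
    next
      case False
      then have "grad \<phi> x = 0" using L(2,3) by blast
      then show ?thesis by simp
    qed
  qed
  from integral_cong_AE[OF m2 m1 this] show "(LINT x:U|lebesgue. s x \<bullet> grad \<phi> x) = 0"
    using \<sigma>(1) \<phi>' by (simp add: weakly_div_free_def set_lebesgue_integral_def)
qed

theorem theorem6p22:
  fixes \<Omega> \<Omega>p C :: "(real^2) set"
    and w u :: "real^2 \<Rightarrow> real"
    and \<sigma> s :: "real^2 \<Rightarrow> real^2"
    and p :: "(real^2) set \<Rightarrow> real^2"
  assumes "open \<Omega>" and "bounded \<Omega>" and "lipschitz_boundary \<Omega>"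
    and "H1_on \<Omega> w"
    and "minimizer \<Omega> w u \<sigma> p"
    and "\<Omega>p \<subseteq> \<Omega>" and "\<Omega>p \<noteq> {}" and "convex \<Omega>p" and "open \<Omega>p"
    and "AE x in lebesgue. x \<in> \<Omega>p \<longrightarrow> norm (\<sigma> x) = 1"
    and "locally_lipschitz_on \<Omega>p s"
    and "AE x in lebesgue. x \<in> \<Omega>p \<longrightarrow> s x = \<sigma> x"
    and "C \<in> components (fan_complement s \<Omega>p)"
    and "interior C \<noteq> {}"
  shows "continuous_on (closure C - char_boundary s \<Omega>p C) (extended_field s \<Omega>p C)"
proof -
  have cont: "continuous_on \<Omega>p s"
    using assms(11,9) by (rule locally_lipschitz_on_continuous)
  \<comment> \<open>The foliation requires unit length at every point, so the almost everywhere
    statement is first moved from \<sigma> to the continuous \<open>s\<close>.\<close>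
  have "AE x in lebesgue. x \<in> \<Omega>p \<longrightarrow> norm (s x) = 1"
    using assms(10,12) by eventually_elim auto
  then have unit: "norm (s x) = 1" if "x \<in> \<Omega>p" for x
    by (rule eq_on_open_if_AE[OF assms(9) continuous_on_norm[OF cont] _ that])
  have "L2_on \<Omega> \<sigma>" using assms(5) by (simp add: minimizer_def admissible_def)
  then have "weakly_div_free \<Omega>p s"
    by (rule weakly_div_free_representative[OF minimizer_weakly_div_free[OF assms(5,1,2)] _
        assms(1,6,9) cont assms(12)])
  then have pot: "\<exists>r>0. \<exists>\<psi>. ball x0 r \<subseteq> \<Omega>p \<and>
      (\<forall>x\<in>ball x0 r. (\<psi> has_derivative (\<lambda>h. perp (s x) \<bullet> h)) (at x))" if "x0 \<in> \<Omega>p" for x0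
    using local_potential[OF assms(9) cont _ that] by blast
  interpret char_foliation s \<Omega>p
  proof
    show "s y = s x" if "x \<in> \<Omega>p" "y \<in> \<Omega>p" "y \<in> char_line s x" for x y
      by (rule field_constant_on_char_line[OF assms(9,8) cont unit pot that])
  qed (fact assms(9) assms(8) cont unit)+
  show ?thesis using assms(13) by (rule continuous_on_extended_field)
qed

end
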